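(* Let $c\in\{-1,+1\}$, let $f\in C^1(\mathbb{R},\mathbb{R})$ with $f'>0$ on $\mathbb{R}$ and $f(0)=0$, and let $g:\mathbb{R}\to\mathbb{R}$ be differentiable. Assume there is a constant $\gamma$ with $0\le\gamma<1$ such that $|g|\le\gamma|f|$ and $|g'|\le\gamma|f'|$ on $\mathbb{R}$, and assume $\lim_{y\to\pm\infty}f(y)=\pm\infty$. Let $D\in\mathbb{R}$. Then there is a unique $d\in\mathbb{R}$ such that $f(d)+g(d)=D$, and the constant $d$ is the unique globally attractive solution of $$y'(t)+c\,y'(t-1)+f(y(t))+g(y(t-1))=D,\quad t>0,\ t\notin\mathbb{N},\qquad y(t)=y_0(t),\quad -1<t<0,$$ i.e. for every $y_0\in H^1((-1,0),\mathbb{R})$ the solution $y\in H^1_{loc}((-1,+\infty),\mathbb{R})$ satisfies $y(t)\to d$ as $t\to+\infty$.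
   Context: The equation is a neutral delay differential equation with delay $1$; it is understood to hold for almost every $t>0$ (derivatives are weak derivatives). Functions in $H^1_{loc}$ are identified with their continuous representatives. *)

theory Defs
  imports "HOL-Analysis.Analysis"
begin

definition test_function :: "real set \<Rightarrow> (real \<Rightarrow> real) \<Rightarrow> bool" where
  "test_function I \<phi> \<longleftrightarrow>
     (\<forall>k x. (deriv ^^ k) \<phi> differentiable (at x)) \<and>
     compact (closure {x. \<phi> x \<noteq> 0}) \<and> closure {x. \<phi> x \<noteq> 0} \<subseteq> I"

definition locally_integrable_on :: "(real \<Rightarrow> real) \<Rightarrow> real set \<Rightarrow> bool" where
  "locally_integrable_on u I \<longleftrightarrow> (\<forall>K. compact K \<and> K \<subseteq> I \<longrightarrow> set_integrable lebesgue K u)"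

definition has_weak_derivative_on ::
    "(real \<Rightarrow> real) \<Rightarrow> (real \<Rightarrow> real) \<Rightarrow> real set \<Rightarrow> bool" where
  "has_weak_derivative_on u v I \<longleftrightarrow>
     locally_integrable_on u I \<and> locally_integrable_on v I \<and>
     (\<forall>\<phi>. test_function I \<phi> \<longrightarrow>
        (LINT t:I|lebesgue. u t * deriv \<phi> t) = - (LINT t:I|lebesgue. v t * \<phi> t))"

definition square_integrable_on :: "(real \<Rightarrow> real) \<Rightarrow> real set \<Rightarrow> bool" where
  "square_integrable_on u I \<longleftrightarrow>
     set_borel_measurable lebesgue I u \<and> set_integrable lebesgue I (\<lambda>t. (u t)\<^sup>2)"

(* The elements of H1 and H1_loc are the continuous representatives of the
   Sobolev classes; only their values on I matter. *)
definition H1 :: "real set \<Rightarrow> (real \<Rightarrow> real) set" where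
  "H1 I = {u. continuous_on I u \<and> square_integrable_on u I \<and>
              (\<exists>v. has_weak_derivative_on u v I \<and> square_integrable_on v I)}"

definition H1_loc :: "real set \<Rightarrow> (real \<Rightarrow> real) set" where
  "H1_loc I = {u. \<forall>U. open U \<and> compact (closure U) \<and> closure U \<subseteq> I \<longrightarrow> u \<in> H1 U}"

(* The weak derivative v is determined up to a null set, so it is immaterial which
   one is chosen; the exceptional times t \<in> \<nat> form a null set as well. *)
definition neutral_solution ::
    "real \<Rightarrow> (real \<Rightarrow> real) \<Rightarrow> (real \<Rightarrow> real) \<Rightarrow> real \<Rightarrow>
     (real \<Rightarrow> real) \<Rightarrow> (real \<Rightarrow> real) \<Rightarrow> bool" where
  "neutral_solution c f g D y0 y \<longleftrightarrow>
     y \<in> H1_loc {-1<..} \<and>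
     (\<exists>v. has_weak_derivative_on y v {-1<..} \<and>
          (AE t in lebesgue. t > 0 \<longrightarrow> v t + c * v (t - 1) + f (y t) + g (y (t - 1)) = D)) \<and>
     (\<forall>t\<in>{-1<..<0}. y t = y0 t)"

(* Speaking of "the solution" for given initial data presupposes well-posedness, hence
   the existence and uniqueness clauses; solutions are compared only on (-1, \<infinity>). *)
definition globally_attractive_constant ::
    "real \<Rightarrow> (real \<Rightarrow> real) \<Rightarrow> (real \<Rightarrow> real) \<Rightarrow> real \<Rightarrow> real \<Rightarrow> bool" where
  "globally_attractive_constant c f g D d \<longleftrightarrow>
     neutral_solution c f g D (\<lambda>_. d) (\<lambda>_. d) \<and>
     (\<forall>y0\<in>H1 {-1<..<0}.
        (\<exists>y. neutral_solution c f g D y0 y) \<and>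
        (\<forall>y z. neutral_solution c f g D y0 y \<and> neutral_solution c f g D y0 z \<longrightarrow>
               (\<forall>t>-1. y t = z t)) \<and>
        (\<forall>y. neutral_solution c f g D y0 y \<longrightarrow> (y \<longlongrightarrow> d) at_top))"

end

theory Submission
  imports Defs
begin

text \<open>
  Write \<open>F = f - f d\<close>, \<open>G = g - g d\<close>, so that \<open>\<bar>G\<bar> \<le> \<gamma> \<bar>F\<bar>\<close>. Squaring
  \<open>y'(t) + F (y t) = - (c y'(t - 1) + G (y (t - 1)))\<close> and using \<open>c\<^sup>2 = 1\<close>, the cross terms are
  derivatives of \<open>\<Phi> (y t)\<close> and \<open>\<Gamma> (y t)\<close> for antiderivatives \<open>\<Phi>\<close>, \<open>\<Gamma>\<close> of \<open>F\<close>, \<open>G\<close>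
  with \<open>\<bar>\<Gamma>\<bar> \<le> \<gamma> \<Phi>\<close>, and the integrals of \<open>y'\<^sup>2\<close> telescope. This leaves
  \<open>\<integral>\<^bsub>T-1\<^esub>\<^bsup>T\<^esup> y'\<^sup>2 + 2 \<Phi> (y T) + (1 - \<gamma>\<^sup>2) \<integral> (F \<circ> y)\<^sup>2 \<le> C + 2 \<gamma> \<Phi> (y (T - 1))\<close>.
  As \<open>\<gamma> < 1\<close>, all three terms on the left are bounded: \<open>y\<close> is uniformly
  continuous and \<open>(F \<circ> y)\<^sup>2\<close> is integrable, which forces \<open>y t \<longlonglongrightarrow> d\<close>.
  Well-posedness is by steps of length 1, on each of which \<open>y\<close> solves a scalar integral equation
  with monotone nonlinearity \<open>f\<close>. The energy identity rests on the chain rule for primitives of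
  integrable functions; a function with a weak derivative is such a primitive.
\<close>

subsection \<open>Primitives of integrable functions\<close>

text \<open>The equation does not smooth: \<open>v t\<close> inherits the roughness of
  \<open>v (t - 1)\<close>, so \<open>v\<close> stays merely square integrable for all times. Hence
  all calculus uses the identity \<open>u b - u a = integral {a..b} v\<close>, that is, local
  absolute continuity of \<open>u\<close> with derivative \<open>v\<close>, and never a pointwise
  derivative of a solution. Boundedness comes from a recursion: dropping the two nonnegative
  integrals leaves \<open>\<Phi> (y T) \<le> C / 2 + \<gamma> * \<Phi> (y (T - 1))\<close>, a
  contraction as \<open>\<gamma> < 1\<close>. Once \<open>\<Phi> (y t)\<close> is bounded, so is the
  right side of the energy estimate, and with it both integrals. The energy is started at a positive
  time, since \<open>H1_loc\<close> controls \<open>v\<close> only on compact parts of the open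
  half-line. For existence the unknown is the derivative: pieces of a derivative can be glued
  freely, and their integral is continuous at the joints. As \<open>f\<close> may grow arbitrarily
  fast, it is first cut off, and an a priori bound then shows that the cut-off is never
  reached.\<close>

definition primitive_on :: "(real \<Rightarrow> real) \<Rightarrow> (real \<Rightarrow> real) \<Rightarrow> real set \<Rightarrow> bool" where
  "primitive_on u v I \<longleftrightarrow>
     (\<forall>a b. a \<le> b \<longrightarrow> {a..b} \<subseteq> I \<longrightarrow>
        v absolutely_integrable_on {a..b} \<and> u b - u a = integral {a..b} v)"

text \<open>Quantifying over compact subintervals makes one notion serve twice: on an open
  \<open>I\<close> it is the local space, on a closed interval it is square integrability up to the
  ends. Integrability of \<open>v\<close> itself is included because it carries
  measurability.\<close>

definition locally_L2_on :: "(real \<Rightarrow> real) \<Rightarrow> real set \<Rightarrow> bool" where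
  "locally_L2_on v I \<longleftrightarrow>
     (\<forall>a b. {a..b} \<subseteq> I \<longrightarrow>
        v absolutely_integrable_on {a..b} \<and> (\<lambda>t. (v t)\<^sup>2) absolutely_integrable_on {a..b})"

lemma abs_integrable_imp_integrable:
  "v absolutely_integrable_on S \<Longrightarrow> v integrable_on S" for v :: "real \<Rightarrow> real"
  by (simp add: absolutely_integrable_on_def)

lemma primitive_onD:
  assumes "primitive_on u v I" "a \<le> b" "{a..b} \<subseteq> I"
  shows "v absolutely_integrable_on {a..b}" "v integrable_on {a..b}"
    "u b - u a = integral {a..b} v"
  using assms unfolding primitive_on_def absolutely_integrable_on_def by blast+

lemma primitive_on_subset: "primitive_on u v I \<Longrightarrow> J \<subseteq> I \<Longrightarrow> primitive_on u v J"
  unfolding primitive_on_def by blast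

lemma primitive_on_continuous_Icc:
  assumes "primitive_on u v {a..b}"
  shows "continuous_on {a..b} u"
proof (cases "a \<le> b")
  case True
  have "v integrable_on {a..b}" using primitive_onD[OF assms True] by simp
  then have "continuous_on {a..b} (\<lambda>t. u a + integral {a..t} v)"
    by (intro continuous_intros indefinite_integral_continuous_1)
  moreover have "u a + integral {a..t} v = u t" if "t \<in> {a..b}" for t
  proof -
    have "{a..t} \<subseteq> {a..b}" using that by auto
    then show ?thesis using primitive_onD(3)[OF assms, of a t] that by auto
  qed
  ultimately show ?thesis by (rule continuous_on_eq)
qed auto

lemma primitive_on_continuous:
  assumes "primitive_on u v I" "open I"
  shows "continuous_on I u"
proof -
  have "isCont u t" if t: "t \<in> I" for t
  proof -
    obtain e where e: "e > 0" "cball t e \<subseteq> I"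
      using assms(2) t by (meson open_contains_cball)
    then have "{t-e..t+e} \<subseteq> I" unfolding cball_eq_atLeastAtMost by simp
    then have "continuous_on {t-e..t+e} u"
      using primitive_on_continuous_Icc primitive_on_subset[OF assms(1)] by blast
    then show ?thesis using e(1)
      by (intro continuous_on_interior[of "{t-e..t+e}"]) auto
  qed
  then show ?thesis by (simp add: continuous_at_imp_continuous_on)
qed

text \<open>Two coefficients let one rule cover sums, differences and negatives, which is where
  later terms such as \<open>1 * y t + (-1) * z t\<close> come from.\<close>

lemma primitive_on_lin:
  assumes "primitive_on u v I" "primitive_on u' v' I"
  shows "primitive_on (\<lambda>t. p * u t + q * u' t) (\<lambda>t. p * v t + q * v' t) I"
  unfolding primitive_on_def
proof (intro allI impI conjI)
  fix a b :: real assume ab: "a \<le> b" "{a..b} \<subseteq> I"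
  note d = primitive_onD[OF assms(1) ab] primitive_onD[OF assms(2) ab]
  show "(\<lambda>t. p * v t + q * v' t) absolutely_integrable_on {a..b}"
    by (intro set_integral_add(1) set_integrable_mult_right) (simp_all add: d)
  have "integral {a..b} (\<lambda>t. p * v t + q * v' t) = p * integral {a..b} v + q * integral {a..b} v'"
    using d by (subst integral_add) (auto intro: integrable_on_mult_right)
  with d show "p * u b + q * u' b - (p * u a + q * u' a) = integral {a..b} (\<lambda>t. p * v t + q * v' t)"
    by (metis add_diff_add right_diff_distrib)
qed

lemma abs_integrable_cont_mult:
  fixes h v :: "real \<Rightarrow> real"
  assumes "continuous_on {a..b} h" "v absolutely_integrable_on {a..b}"
  shows "(\<lambda>t. h t * v t) absolutely_integrable_on {a..b}"
proof -
  have "h \<in> borel_measurable (lebesgue_on {a..b})"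
    using assms(1) by (simp add: continuous_imp_measurable_on_sets_lebesgue)
  moreover have "bounded (h ` {a..b})"
    using assms(1) by (simp add: compact_continuous_image compact_imp_bounded)
  ultimately show ?thesis
    using absolutely_integrable_bounded_measurable_product_real[of h "{a..b}" v] assms(2) by simp
qed

lemma integral_split_Icc:
  fixes v :: "real \<Rightarrow> real"
  assumes "v integrable_on {a..c}" "a \<le> b" "b \<le> c"
  shows "integral {a..c} v = integral {a..b} v + integral {b..c} v"
  using Henstock_Kurzweil_Integration.integral_combine[of a b c v] assms by simp

text \<open>On a short interval around \<open>x\<close> the error of the claimed identity is at most
  a small multiple of the integral of \<open>\<bar>v\<bar>\<close>. Such a bound is additive in the
  interval, so bisection carries it from short intervals to \<open>{a..b}\<close>.\<close>

lemma chain_rule_primitive: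
  fixes \<Phi> F u v :: "real \<Rightarrow> real"
  assumes \<Phi>: "\<And>x. (\<Phi> has_real_derivative F x) (at x)" and F: "continuous_on UNIV F"
    and uv: "primitive_on u v I"
  shows "primitive_on (\<lambda>t. \<Phi> (u t)) (\<lambda>t. F (u t) * v t) I"
  unfolding primitive_on_def
proof (intro allI impI conjI)
  fix a b :: real assume ab: "a \<le> b" "{a..b} \<subseteq> I"
  have uv': "primitive_on u v {a..b}" using uv ab(2) primitive_on_subset by blast
  have cu: "continuous_on {a..b} u" by (rule primitive_on_continuous_Icc[OF uv'])
  have cFu: "continuous_on {a..b} (\<lambda>t. F (u t))"
    by (rule continuous_on_compose2[OF F cu]) auto
  note v = primitive_onD[OF uv' ab(1) subset_refl]
  show Fv: "(\<lambda>t. F (u t) * v t) absolutely_integrable_on {a..b}"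
    by (rule abs_integrable_cont_mult[OF cFu v(1)])
  have Fvi: "(\<lambda>t. F (u t) * v t) integrable_on {a..b}" 
    using Fv by (rule abs_integrable_imp_integrable)
  have av: "(\<lambda>t. \<bar>v t\<bar>) integrable_on {a..b}"
    using v(1) by (simp add: absolutely_integrable_on_def)
  \<comment> \<open>The factor 2 leaves one \<open>e\<close> for linearising \<open>\<Phi>\<close>
    at \<open>u x\<close> and one for freezing \<open>F (u t)\<close> at \<open>F (u x)\<close>. The
    guard is there because the intervals around \<open>x\<close> in the bisection principle may
    stick out of \<open>{a..b}\<close>.\<close>
  define P where "P = (\<lambda>e s t. {s..t} \<subseteq> {a..b} \<longrightarrow>
     \<bar>\<Phi> (u t) - \<Phi> (u s) - integral {s..t} (\<lambda>t. F (u t) * v t)\<bar> \<le> 2 * e * integral {s..t} (\<lambda>t. \<bar>v t\<bar>))"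
  have "P e a b" if e: "e > 0" for e
    using ab(1)
  proof (induction rule: Bolzano)
    case (trans r s t)
    show ?case unfolding P_def
    proof
      assume rt: "{r..t} \<subseteq> {a..b}"
      have i: "integral {r..t} g = integral {r..s} g + integral {s..t} g" if "g integrable_on {a..b}" for g :: "real \<Rightarrow> real"
        using integrable_on_subinterval[OF that rt] trans(3,4) by (rule integral_split_Icc)
      have "{r..s} \<subseteq> {a..b}" "{s..t} \<subseteq> {a..b}"
        using rt trans(3,4) by auto
      then show "\<bar>\<Phi> (u t) - \<Phi> (u r) - integral {r..t} (\<lambda>t. F (u t) * v t)\<bar> \<le> 2 * e * integral {r..t} (\<lambda>t. \<bar>v t\<bar>)"
        using trans(1,2) unfolding P_def i[OF Fvi] i[OF av] by (simp add: algebra_simps)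
    qed
  next
    case (local x)
    have "isCont F (u x)" using F by (simp add: continuous_on_eq_continuous_at)
    then obtain \<eta> where \<eta>: "\<eta> > 0" "\<And>y. \<bar>y - u x\<bar> < \<eta> \<Longrightarrow> \<bar>F y - F (u x)\<bar> < e"
      using e unfolding continuous_at_eps_delta dist_real_def by metis
    obtain d where d: "d > 0" "\<And>y. y \<in> {a..b} \<Longrightarrow> \<bar>y - x\<bar> < d \<Longrightarrow> \<bar>u y - u x\<bar> < \<eta>"
      using cu local \<eta>(1) unfolding continuous_on_iff dist_real_def by (metis atLeastAtMost_iff)
    show ?case
    proof (intro exI[of _ d] conjI allI impI d(1))
      fix s t assume st: "s \<le> x \<and> x \<le> t \<and> t - s < d"
      show "P e s t" unfolding P_def
      proof
        assume sub: "{s..t} \<subseteq> {a..b}"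
        have st': "s \<le> t" using st by linarith
        have near: "\<bar>u y - u x\<bar> < \<eta>" if "y \<in> {s..t}" for y
        proof (rule d(2))
          show "y \<in> {a..b}" using sub that by blast
          show "\<bar>y - x\<bar> < d" using st that by auto
        qed
        note vst = primitive_onD[OF uv' st' sub]
        have avst: "(\<lambda>t. \<bar>v t\<bar>) integrable_on {s..t}"
          using vst(1) by (simp add: absolutely_integrable_on_def)
        have Fvst: "(\<lambda>t. F (u t) * v t) integrable_on {s..t}"
          using Fvi sub integrable_on_subinterval by blast
        \<comment> \<open>After subtracting the tangent at \<open>u x\<close>, the remainder of
          \<open>\<Phi>\<close> has derivative \<open>F z - F (u x)\<close>, at most
          \<open>e\<close> in size on the ball; the mean value inequality applies.\<close>
        have 1: "\<bar>(\<Phi> (u t) - F (u x) * u t) - (\<Phi> (u s) - F (u x) * u s)\<bar> \<le> e * \<bar>u t - u s\<bar>"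
        proof -
          have "norm ((\<Phi> (u t) - F (u x) * u t) - (\<Phi> (u s) - F (u x) * u s)) \<le> e * norm (u t - u s)"
          proof (rule field_differentiable_bound[of "ball (u x) \<eta>" "\<lambda>y. \<Phi> y - F (u x) * y" "\<lambda>y. F y - F (u x)"])
            fix z assume z: "z \<in> ball (u x) \<eta>"
            have "((\<lambda>y. \<Phi> y - F (u x) * y) has_real_derivative F z - F (u x)) (at z)"
              by (auto intro!: derivative_eq_intros \<Phi>)
            then show "((\<lambda>y. \<Phi> y - F (u x) * y) has_real_derivative F z - F (u x)) (at z within ball (u x) \<eta>)"
              by (rule has_field_derivative_at_within)
            show "norm (F z - F (u x)) \<le> e" using \<eta>(2)[of z] z by (simp add: dist_real_def abs_minus_commute)
          qed (use near st' in \<open>auto simp: dist_real_def abs_minus_commute\<close>)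
          then show ?thesis by simp
        qed
        have 2: "\<bar>u t - u s\<bar> \<le> integral {s..t} (\<lambda>t. \<bar>v t\<bar>)"
          unfolding vst(3) using integral_norm_bound_integral[OF vst(2) avst] by simp
        have "F (u x) * (u t - u s) - integral {s..t} (\<lambda>t. F (u t) * v t)
            = integral {s..t} (\<lambda>t. F (u x) * v t - F (u t) * v t)"
          using vst(2) Fvst unfolding vst(3) by (subst integral_diff) (auto intro: integrable_on_mult_right)
        also have "\<bar>\<dots>\<bar> \<le> integral {s..t} (\<lambda>t. e * \<bar>v t\<bar>)"
        proof -
          have "norm (F (u x) * v y - F (u y) * v y) \<le> e * \<bar>v y\<bar>" if "y \<in> {s..t}" for y
          proof -
            have "\<bar>F (u x) - F (u y)\<bar> \<le> e" using \<eta>(2)[OF near[OF that]] by linarith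
            then have "\<bar>F (u x) - F (u y)\<bar> * \<bar>v y\<bar> \<le> e * \<bar>v y\<bar>" by (rule mult_right_mono) simp
            then show ?thesis by (simp add: abs_mult left_diff_distrib[symmetric])
          qed
          moreover have "(\<lambda>t. F (u x) * v t - F (u t) * v t) integrable_on {s..t}"
            by (intro integrable_diff integrable_on_mult_right vst(2) Fvst)
          moreover have "(\<lambda>t. e * \<bar>v t\<bar>) integrable_on {s..t}"
            by (intro integrable_on_mult_right avst)
          ultimately show ?thesis
            unfolding real_norm_def[symmetric] by (intro integral_norm_bound_integral)
        qed
        finally have 3: "\<bar>F (u x) * (u t - u s) - integral {s..t} (\<lambda>t. F (u t) * v t)\<bar> \<le> e * integral {s..t} (\<lambda>t. \<bar>v t\<bar>)"
          by simp
        have "e * \<bar>u t - u s\<bar> \<le> e * integral {s..t} (\<lambda>t. \<bar>v t\<bar>)"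
          using 2 e by simp
        then show "\<bar>\<Phi> (u t) - \<Phi> (u s) - integral {s..t} (\<lambda>t. F (u t) * v t)\<bar> \<le> 2 * e * integral {s..t} (\<lambda>t. \<bar>v t\<bar>)"
          using 1 3 by (simp add: algebra_simps abs_le_iff)
      qed
    qed
  qed
  then have le: "\<bar>\<Phi> (u b) - \<Phi> (u a) - integral {a..b} (\<lambda>t. F (u t) * v t)\<bar> \<le> 2 * e * integral {a..b} (\<lambda>t. \<bar>v t\<bar>)"
    if "e > 0" for e using that unfolding P_def by simp
  have "((\<lambda>e. 2 * e * integral {a..b} (\<lambda>t. \<bar>v t\<bar>)) \<longlongrightarrow> 2 * 0 * integral {a..b} (\<lambda>t. \<bar>v t\<bar>)) (at_right 0)"
    by (intro tendsto_intros)
  then have "\<bar>\<Phi> (u b) - \<Phi> (u a) - integral {a..b} (\<lambda>t. F (u t) * v t)\<bar> \<le> 2 * 0 * integral {a..b} (\<lambda>t. \<bar>v t\<bar>)"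
    by (rule tendsto_lowerbound) (use le in \<open>auto simp: eventually_at_right_less eventually_at_filter\<close>)
  then show "\<Phi> (u b) - \<Phi> (u a) = integral {a..b} (\<lambda>t. F (u t) * v t)" by simp
qed

text \<open>Polarisation: \<open>u * u'\<close> is a quarter of the difference of the squares of
  \<open>u + u'\<close> and \<open>u - u'\<close>, so the chain rule for squares suffices.\<close>

lemma product_rule_primitive:
  assumes "primitive_on u v I" "primitive_on u' v' I"
  shows "primitive_on (\<lambda>t. u t * u' t) (\<lambda>t. u t * v' t + v t * u' t) I"
proof -
  have sq: "primitive_on (\<lambda>t. (w t)\<^sup>2) (\<lambda>t. 2 * w t * x t) I" if "primitive_on w x I" for w x
  proof (rule chain_rule_primitive[of "\<lambda>x. x\<^sup>2" "\<lambda>x. 2 * x", OF _ _ that])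
    show "((\<lambda>x. x\<^sup>2) has_real_derivative 2 * x) (at x)" for x :: real
      by (auto intro!: derivative_eq_intros)
  qed (intro continuous_intros)
  have "primitive_on (\<lambda>t. (1/4) * (1 * u t + 1 * u' t)\<^sup>2 + (-1/4) * (1 * u t + (-1) * u' t)\<^sup>2)
     (\<lambda>t. (1/4) * (2 * (1 * u t + 1 * u' t) * (1 * v t + 1 * v' t)) +
        (-1/4) * (2 * (1 * u t + (-1) * u' t) * (1 * v t + (-1) * v' t))) I"
    by (rule primitive_on_lin[OF sq[OF primitive_on_lin[OF assms]] sq[OF primitive_on_lin[OF assms]]])
  moreover have "(\<lambda>t. (1/4) * (1 * u t + 1 * u' t)\<^sup>2 + (-1/4) * (1 * u t + (-1) * u' t)\<^sup>2)
      = (\<lambda>t. u t * u' t)"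
    by (simp add: fun_eq_iff power2_eq_square field_simps)
  moreover have "(\<lambda>t. (1/4) * (2 * (1 * u t + 1 * u' t) * (1 * v t + 1 * v' t)) +
        (-1/4) * (2 * (1 * u t + (-1) * u' t) * (1 * v t + (-1) * v' t))) = (\<lambda>t. u t * v' t + v t * u' t)"
    by (simp add: fun_eq_iff field_simps)
  ultimately show ?thesis by simp
qed

subsection \<open>Smooth step functions\<close>

definition smooth :: "(real \<Rightarrow> real) \<Rightarrow> bool" where
  "smooth f \<longleftrightarrow> (\<forall>k x. (deriv ^^ k) f differentiable (at x))"

lemma smooth_DERIV: "smooth f \<Longrightarrow> (f has_real_derivative deriv f x) (at x)"
  unfolding smooth_def using DERIV_deriv_iff_real_differentiable[of f x]
  by (metis funpow_0)

lemma smooth_deriv: "smooth f \<Longrightarrow> smooth (deriv f)"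
  unfolding smooth_def by (metis comp_apply funpow_Suc_right)

lemma smooth_of_DERIV:
  assumes "\<And>x. (f has_real_derivative g x) (at x)" "smooth g"
  shows "smooth f"
proof -
  have "deriv f = g" using assms(1) by (simp add: fun_eq_iff DERIV_imp_deriv)
  then have "(deriv ^^ k) f differentiable (at x)" for k x
    using assms by (cases k) (auto simp: smooth_def funpow_Suc_right real_differentiable_def
        simp del: funpow.simps(2))
  then show ?thesis by (simp add: smooth_def)
qed

lemma smooth_affine:
  assumes "smooth f"
  shows "smooth (\<lambda>x. f (m * x + q))"
proof -
  have diff: "((\<lambda>x. m ^ k * (deriv ^^ k) f (m * x + q)) has_real_derivative
      m ^ Suc k * (deriv ^^ Suc k) f (m * x + q)) (at x)" for k x
  proof -
    have "((deriv ^^ k) f has_real_derivative (deriv ^^ Suc k) f y) (at y)" for y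
      using assms DERIV_deriv_iff_real_differentiable unfolding smooth_def by simp
    then have "((\<lambda>x. (deriv ^^ k) f (m * x + q)) has_real_derivative (deriv ^^ Suc k) f (m * x + q) * m) (at x)"
      by (rule DERIV_chain2) (auto intro!: derivative_eq_intros)
    from DERIV_cmult[OF this, of "m ^ k"] show ?thesis by (simp add: mult_ac)
  qed
  have "(deriv ^^ k) (\<lambda>x. f (m * x + q)) = (\<lambda>x. m ^ k * (deriv ^^ k) f (m * x + q))"
    (is "(deriv ^^ k) ?f = ?d k") for k
  proof (induction k)
    case (Suc k)
    have "(deriv ^^ Suc k) ?f = deriv ((deriv ^^ k) ?f)" by simp
    also have "\<dots> = ?d (Suc k)" unfolding Suc using DERIV_imp_deriv[OF diff[of k]] by blast
    finally show ?case .
  qed simp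
  then show ?thesis unfolding smooth_def using diff real_differentiable_def by metis
qed

lemma smooth_diff:
  assumes "smooth f" "smooth g"
  shows "smooth (\<lambda>x. f x - g x)"
proof -
  have diff: "((\<lambda>x. (deriv ^^ k) f x - (deriv ^^ k) g x) has_real_derivative
      (deriv ^^ Suc k) f x - (deriv ^^ Suc k) g x) (at x)" for k x
    using assms DERIV_deriv_iff_real_differentiable unfolding smooth_def
    by (intro DERIV_diff) auto
  have "(deriv ^^ k) (\<lambda>x. f x - g x) = (\<lambda>x. (deriv ^^ k) f x - (deriv ^^ k) g x)"
    (is "(deriv ^^ k) ?f = ?d k") for k
  proof (induction k)
    case (Suc k)
    have "(deriv ^^ Suc k) ?f = deriv ((deriv ^^ k) ?f)" by simp
    also have "\<dots> = ?d (Suc k)" unfolding Suc using DERIV_imp_deriv[OF diff[of k]] by blast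
    finally show ?case .
  qed simp
  then show ?thesis unfolding smooth_def using diff real_differentiable_def by metis
qed

text \<open>Serves the points where piecewise formulas meet: the ends of the bump, and later the
  threshold of a squared positive part.\<close>

lemma DERIV_zero_of_quadratic_bound:
  fixes f :: "real \<Rightarrow> real"
  assumes "\<And>y. \<bar>f y - f x\<bar> \<le> C * (y - x)\<^sup>2"
  shows "(f has_real_derivative 0) (at x)"
  unfolding has_field_derivative_iff
proof (rule Lim_null_comparison)
  show "\<forall>\<^sub>F y in at x. norm ((f y - f x) / (y - x)) \<le> C * \<bar>y - x\<bar>"
  proof (rule eventually_at_filter[THEN iffD2], intro always_eventually allI impI)
    fix y assume "y \<noteq> x"
    have "\<bar>f y - f x\<bar> \<le> (C * \<bar>y - x\<bar>) * \<bar>y - x\<bar>"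
      using assms[of y] by (simp add: power2_eq_square mult.assoc)
    then show "norm ((f y - f x) / (y - x)) \<le> C * \<bar>y - x\<bar>"
      using \<open>y \<noteq> x\<close> by (simp add: abs_divide divide_le_eq)
  qed
  have "((\<lambda>y. C * \<bar>y - x\<bar>) \<longlongrightarrow> C * \<bar>x - x\<bar>) (at x)"
    by (intro tendsto_intros)
  then show "((\<lambda>y. C * \<bar>y - x\<bar>) \<longlongrightarrow> 0) (at x)" by simp
qed

text \<open>The derivatives of the standard bump \<open>exp (- 1 / (1 - x\<^sup>2))\<close> stay in this family.\<close>

definition bump :: "real poly \<Rightarrow> nat \<Rightarrow> real \<Rightarrow> real" where
  "bump p k x = (if \<bar>x\<bar> < 1 then poly p x / (1 - x\<^sup>2) ^ k * exp (- 1 / (1 - x\<^sup>2)) else 0)"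

lemma one_minus_square_pos: "\<bar>x\<bar> < 1 \<Longrightarrow> 0 < 1 - x\<^sup>2" for x :: real
  using abs_square_less_1[of x] by simp

lemma exp_ge_term:
  fixes x :: real
  assumes "0 \<le> x"
  shows "x ^ n / fact n \<le> exp x"
proof -
  have "(\<Sum>n\<in>{n}. x ^ n /\<^sub>R fact n) \<le> (\<Sum>n. x ^ n /\<^sub>R fact n)"
    by (rule sum_le_suminf[OF summable_exp_generic]) (use assms in auto)
  then show ?thesis by (simp add: exp_def divide_inverse mult.commute)
qed

text \<open>Of the series of \<open>exp (1 / w)\<close> only the term of order \<open>k + 2\<close>
  is kept: \<open>k\<close> orders absorb the pole, and the two extra ones leave
  \<open>w\<^sup>2\<close>, enough for a vanishing derivative at the end points.\<close>

lemma exp_inverse_bound: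
  fixes w :: real
  assumes "0 < w"
  shows "exp (- 1 / w) / w ^ k \<le> fact (k + 2) * w\<^sup>2"
proof -
  define n where "n = k + 2"
  have "exp (- 1 / w) * ((1 / w) ^ n / fact n) \<le> exp (- 1 / w) * exp (1 / w)"
    using assms by (intro mult_left_mono exp_ge_term) auto
  also have "\<dots> = 1" by (simp flip: exp_add)
  finally have "exp (- 1 / w) / w ^ n \<le> fact n"
    using assms by (simp add: power_one_over divide_simps mult.commute)
  moreover have "exp (- 1 / w) / w ^ k = (exp (- 1 / w) / w ^ n) * w\<^sup>2"
    using assms by (simp add: n_def power_add power2_eq_square)
  ultimately show ?thesis
    unfolding n_def by (metis mult_right_mono zero_le_power2)
qed

lemma bump_boundary:
  obtains C where "\<And>x y. \<bar>x\<bar> \<ge> 1 \<Longrightarrow> \<bar>bump p k y - bump p k x\<bar> \<le> C * (y - x)\<^sup>2"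
proof -
  have "compact (poly p ` {-1..1})"
    by (intro compact_continuous_image continuous_intros) simp
  then obtain B where B: "\<And>y. y \<in> {-1..1} \<Longrightarrow> \<bar>poly p y\<bar> \<le> B"
    by (metis compact_imp_bounded bounded_iff imageI real_norm_def)
  have B0: "0 \<le> B" using B[of 0] by simp
  have "\<bar>bump p k y - bump p k x\<bar> \<le> (B * (fact (k + 2) * 4)) * (y - x)\<^sup>2" if x: "\<bar>x\<bar> \<ge> 1" for x y
  proof (cases "\<bar>y\<bar> < 1")
    case True
    define w where "w = 1 - y\<^sup>2"
    have w: "0 < w" using one_minus_square_pos[OF True] by (simp add: w_def)
    \<comment> \<open>As \<open>1 \<le> \<bar>x\<bar>\<close>, the gap
      \<open>1 - \<bar>y\<bar>\<close> is at most \<open>\<bar>y - x\<bar>\<close>. So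
      \<open>w\<close> is at most twice the distance to \<open>x\<close>, which turns
      \<open>w\<^sup>2\<close> into the required quadratic bound.\<close>
    have "w = (1 - \<bar>y\<bar>) * (1 + \<bar>y\<bar>)" by (simp add: w_def algebra_simps power2_eq_square abs_mult_self_eq)
    also have "\<dots> \<le> (1 - \<bar>y\<bar>) * 2" using True by (intro mult_left_mono) auto
    also have "\<dots> \<le> \<bar>2 * (y - x)\<bar>" using x by simp
    finally have "w\<^sup>2 \<le> (2 * (y - x))\<^sup>2" using w by (simp add: abs_le_square_iff[symmetric])
    then have w2: "w\<^sup>2 \<le> 4 * (y - x)\<^sup>2" by (simp only: power_mult_distrib) simp
    have "\<bar>bump p k y\<bar> = \<bar>poly p y\<bar> * (exp (- 1 / w) / w ^ k)"
      using True w by (simp add: bump_def w_def abs_mult)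
    also have "\<dots> \<le> B * (fact (k + 2) * w\<^sup>2)"
      using True w exp_inverse_bound[OF w, of k] B[of y] B0
      by (intro mult_mono) (auto simp: abs_less_iff)
    also have "\<dots> \<le> B * (fact (k + 2) * (4 * (y - x)\<^sup>2))"
      using w2 B0 by (intro mult_left_mono) auto
    finally show ?thesis using x by (simp add: bump_def mult.assoc)
  next
    case False
    then show ?thesis using x B0 by (simp add: bump_def)
  qed
  then show thesis using that by blast
qed

text \<open>Here \<open>[:1, 0, -1:]\<close> is \<open>1 - x\<^sup>2\<close> and
  \<open>[:0, 1:]\<close> is \<open>x\<close>. The three summands differentiate the polynomial, the
  power in the denominator and the exponential, all brought over the denominator of exponent
  \<open>k + 2\<close>.\<close>

lemma DERIV_bump:
  "(bump p k has_real_derivative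
     bump ([:1, 0, -1:]\<^sup>2 * pderiv p + smult (2 * real k) ([:0, 1:] * [:1, 0, -1:] * p) - smult 2 ([:0, 1:] * p)) (k + 2) x)
   (at x)" (is "(_ has_real_derivative bump ?p _ _) _")
proof (cases "\<bar>x\<bar> < 1")
  case True
  define r where "r = (\<lambda>x::real. 1 / (1 - x\<^sup>2))"
  have w: "0 < 1 - x\<^sup>2" by (rule one_minus_square_pos[OF True])
  have r: "(r has_real_derivative 2 * x * (r x)\<^sup>2) (at x)"
    unfolding r_def using w
    by (auto intro!: derivative_eq_intros simp: power2_eq_square power_divide)
  have rk: "((\<lambda>x. r x ^ k) has_real_derivative real k * 2 * x * r x * r x ^ k) (at x)"
    using DERIV_power[OF r, of k] by (cases k) (simp_all add: power2_eq_square algebra_simps)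
  have "((\<lambda>x. poly p x * r x ^ k * exp (- r x)) has_real_derivative
      (poly (pderiv p) x + poly p x * (real k * 2 * x * r x) - poly p x * (2 * x * (r x)\<^sup>2)) * r x ^ k * exp (- r x)) (at x)"
    by (rule derivative_eq_intros poly_DERIV rk r refl)+ (simp add: algebra_simps)
  moreover have "(poly (pderiv p) x + poly p x * (real k * 2 * x * r x) - poly p x * (2 * x * (r x)\<^sup>2))
      = poly ?p x * (r x)\<^sup>2"
  proof -
    have rw: "r x * (1 - x\<^sup>2) = 1" using w by (simp add: r_def)
    have "poly ?p x * (r x)\<^sup>2 = poly (pderiv p) x * (r x * (1 - x\<^sup>2))\<^sup>2
        + poly p x * (real k * 2 * x * r x) * (r x * (1 - x\<^sup>2)) - poly p x * (2 * x * (r x)\<^sup>2)"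
      by (simp add: power2_eq_square algebra_simps)
    then show ?thesis unfolding rw by simp
  qed
  ultimately have d: "((\<lambda>x. poly p x * r x ^ k * exp (- r x)) has_real_derivative bump ?p (k + 2) x) (at x)"
    using True by (simp add: bump_def r_def power_inverse power_add power2_eq_square divide_inverse mult_ac)
  show ?thesis
    by (rule has_field_derivative_transform_within_open[OF d, of "{-1<..<1}"])
      (use True in \<open>auto simp: bump_def r_def power_inverse divide_inverse\<close>)
next
  case False
  obtain C where "\<And>y. \<bar>bump p k y - bump p k x\<bar> \<le> C * (y - x)\<^sup>2"
    using bump_boundary False by (metis linorder_not_less)
  then show ?thesis using DERIV_zero_of_quadratic_bound[of "bump p k" x C] False by (simp add: bump_def)
qed

lemma smooth_bump: "smooth (bump p k)"
proof -
  have "(deriv ^^ n) (bump p k) differentiable (at x)" for n x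
  proof (induction n arbitrary: p k)
    case 0
    then show ?case using DERIV_bump real_differentiable_def by auto
  next
    case (Suc n)
    have "\<exists>p'. deriv (bump p k) = bump p' (k + 2)"
      using DERIV_imp_deriv[OF DERIV_bump] by blast
    then show ?case using Suc by (auto simp: funpow_Suc_right simp del: funpow.simps(2))
  qed
  then show ?thesis by (simp add: smooth_def)
qed

lemma antiderivative_exists:
  fixes h :: "real \<Rightarrow> real"
  assumes "continuous_on UNIV h"
  obtains H where "\<And>x. (H has_real_derivative h x) (at x)"
proof -
  have "\<exists>F. \<forall>x. - \<infinity> < ereal x \<longrightarrow> ereal x < \<infinity> \<longrightarrow> (F has_vector_derivative h x) (at x)"
    using assms by (intro einterval_antiderivative) (auto simp: continuous_on_eq_continuous_at)
  then show thesis using that by (auto simp: has_real_derivative_iff_has_vector_derivative)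
qed

text \<open>A normalised antiderivative of the bump. A step is the convenient object because it
  gives both things needed later: the derivative of a narrow step approximates a point mass, and the
  difference of two shifted steps has compact support.\<close>

lemma smooth_step_exists:
  obtains R where "smooth R" "\<And>x. 0 \<le> deriv R x" "\<And>x. x \<le> -1 \<Longrightarrow> R x = 0" "\<And>x. x \<ge> 1 \<Longrightarrow> R x = 1"
proof -
  let ?h = "bump [:1:] 0"
  have h0: "?h x \<ge> 0" for x by (simp add: bump_def)
  obtain H where H: "\<And>x. (H has_real_derivative ?h x) (at x)"
    using antiderivative_exists[of ?h] DERIV_bump by (meson DERIV_isCont continuous_at_imp_continuous_on)
  have mono: "H x \<le> H y" if "x \<le> y" for x y
    using DERIV_nonneg_imp_nondecreasing[OF that, of H] H h0 by blast
  have const: "H x = H y" if "x \<le> y" "\<And>z. x < z \<Longrightarrow> z < y \<Longrightarrow> \<bar>z\<bar> \<ge> 1" for x y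
  proof (cases "x = y")
    case False
    have "continuous_on {x..y} H" using H by (meson DERIV_isCont continuous_at_imp_continuous_on)
    moreover have "(H has_real_derivative 0) (at z)" if "x < z" "z < y" for z
      using H[of z] \<open>\<And>z. x < z \<Longrightarrow> z < y \<Longrightarrow> \<bar>z\<bar> \<ge> 1\<close>[OF that] by (simp add: bump_def)
    ultimately show ?thesis using DERIV_isconst2[of x y H y] \<open>x \<le> y\<close> False by auto
  qed simp
  have less: "H (-1) < H 1"
  proof -
    \<comment> \<open>The bump vanishes at both ends of \<open>{-1..1}\<close>, so strict growth is
      taken from the middle half.\<close>
    have "H (-1/2) < H (1/2)"
    proof (rule DERIV_pos_imp_increasing[of "- 1 / 2" "1 / 2" H])
      show "- 1 / 2 < (1 / 2 :: real)" by simp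
      fix x :: real assume "- 1 / 2 \<le> x" "x \<le> 1/2"
      then have "?h x > 0" by (simp add: bump_def)
      then show "\<exists>y. (H has_real_derivative y) (at x) \<and> 0 < y" using H by blast
    qed
    then show ?thesis using mono[of "-1" "-1/2"] mono[of "1/2" 1] by linarith
  qed
  define R where "R = (\<lambda>x. (H x - H (-1)) / (H 1 - H (-1)))"
  \<comment> \<open>Dividing by the total mass only rescales the constant polynomial, so the
    derivative of \<open>R\<close> is again a \<open>bump\<close> and smoothness is
    inherited.\<close>
  have R: "(R has_real_derivative bump [:1 / (H 1 - H (-1)):] 0 x) (at x)" for x
    unfolding R_def using less by (auto intro!: derivative_eq_intros H simp: bump_def)
  then have "smooth R" using smooth_of_DERIV smooth_bump by blast
  moreover have "0 \<le> deriv R x" for x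
    using DERIV_imp_deriv[OF R[of x]] less by (simp add: bump_def)
  moreover have "R x = 0" if "x \<le> -1" for x using const[of x "-1"] that by (simp add: R_def)
  moreover have "R x = 1" if "x \<ge> 1" for x using const[of 1 x] that less by (simp add: R_def)
  ultimately show thesis using that by blast
qed

subsection \<open>Weak derivatives and primitives\<close>

lemma test_function_zero:
  assumes "test_function I \<phi>" "t \<notin> closure {x. \<phi> x \<noteq> 0}"
  shows "\<phi> t = 0" "deriv \<phi> t = 0"
proof -
  show "\<phi> t = 0" using assms(2) closure_subset[of "{x. \<phi> x \<noteq> 0}"] by blast
  have "open (- closure {x. \<phi> x \<noteq> 0})" by auto
  then have "(\<phi> has_real_derivative 0) (at t)"
  proof (rule has_field_derivative_transform_within_open[OF DERIV_const])
    show "t \<in> - closure {x. \<phi> x \<noteq> 0}" using assms(2) by simp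
    show "0 = \<phi> x" if "x \<in> - closure {x. \<phi> x \<noteq> 0}" for x
      using that closure_subset[of "{x. \<phi> x \<noteq> 0}"] by auto
  qed
  then show "deriv \<phi> t = 0" by (rule DERIV_imp_deriv)
qed

lemma test_function_smooth: "test_function I \<phi> \<Longrightarrow> smooth \<phi>"
  by (simp add: test_function_def smooth_def)

lemma test_function_mono: "test_function U \<phi> \<Longrightarrow> U \<subseteq> I \<Longrightarrow> test_function I \<phi>"
  by (auto simp: test_function_def)

lemma has_weak_derivative_on_subset:
  assumes "has_weak_derivative_on u v I" "U \<subseteq> I"
  shows "has_weak_derivative_on u v U"
  unfolding has_weak_derivative_on_def
proof (intro conjI allI impI)
  show "locally_integrable_on u U" "locally_integrable_on v U"
    using assms unfolding has_weak_derivative_on_def locally_integrable_on_def by blast+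
  fix \<phi> assume \<phi>: "test_function U \<phi>"
  have zero: "\<phi> t = 0 \<and> deriv \<phi> t = 0" if "t \<notin> U" for t
    using test_function_zero[OF \<phi>] \<phi> that unfolding test_function_def by blast
  have "(LINT t:U|lebesgue. u t * deriv \<phi> t) = (LINT t:I|lebesgue. u t * deriv \<phi> t)"
    "(LINT t:U|lebesgue. v t * \<phi> t) = (LINT t:I|lebesgue. v t * \<phi> t)"
    unfolding set_lebesgue_integral_def using zero assms(2)
    by (intro Bochner_Integration.integral_cong; force simp: indicator_def)+
  then show "(LINT t:U|lebesgue. u t * deriv \<phi> t) = - (LINT t:U|lebesgue. v t * \<phi> t)"
    using assms test_function_mono[OF \<phi>] unfolding has_weak_derivative_on_def by simp
qed

text \<open>The strict inclusion leaves room at both ends, so that a test function supported in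
  \<open>K\<close> vanishes at \<open>a\<close> and \<open>b\<close>. For empty \<open>K\<close> the
  interval returned is empty too, which is why \<open>weak_derivative_of_primitive\<close>
  distinguishes whether \<open>a \<le> b\<close>.\<close>

lemma compact_in_open_interval:
  fixes K I :: "real set"
  assumes "compact K" "K \<subseteq> I" "open I" "is_interval I"
  obtains a b where "K \<subseteq> {a<..<b}" "{a..b} \<subseteq> I"
proof (cases "K = {}")
  case True
  then show thesis using that[of 1 0] by auto
next
  case False
  obtain l where l: "l \<in> K" "\<And>x. x \<in> K \<Longrightarrow> l \<le> x"
    using compact_attains_inf[OF assms(1) False] by auto
  obtain r where r: "r \<in> K" "\<And>x. x \<in> K \<Longrightarrow> x \<le> r"
    using compact_attains_sup[OF assms(1) False] by auto
  obtain e where e: "e > 0" "cball l e \<subseteq> I" using assms(2,3) l(1) by (meson open_contains_cball subsetD)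
  obtain e' where e': "e' > 0" "cball r e' \<subseteq> I" using assms(2,3) r(1) by (meson open_contains_cball subsetD)
  have "l - e \<in> I" "r + e' \<in> I" using e e' by (auto simp: subset_iff dist_real_def)
  then have "{l - e..r + e'} \<subseteq> I"
    using assms(4) unfolding is_interval_1 by (meson atLeastAtMost_iff subsetI)
  moreover have "K \<subseteq> {l - e<..<r + e'}" using l(2) r(2) e(1) e'(1) by fastforce
  ultimately show thesis using that by blast
qed

text \<open>Bridge between two integrals: weak derivatives are defined by Lebesgue integrals over
  \<open>I\<close>, primitives by gauge integrals over \<open>{a..b}\<close>. They agree here
  because \<open>\<phi>\<close> and \<open>deriv \<phi>\<close> vanish off the support.\<close>

lemma test_function_integral_Icc:
  assumes "test_function I \<phi>" "closure {x. \<phi> x \<noteq> 0} \<subseteq> {a..b}" "{a..b} \<subseteq> I"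
    and "continuous_on {a..b} u" "v absolutely_integrable_on {a..b}"
  shows "(LINT t:I|lebesgue. u t * deriv \<phi> t) = integral {a..b} (\<lambda>t. u t * deriv \<phi> t)"
    and "(LINT t:I|lebesgue. v t * \<phi> t) = integral {a..b} (\<lambda>t. v t * \<phi> t)"
    and "(\<lambda>t. v t * \<phi> t) absolutely_integrable_on {a..b}"
    and "(\<lambda>t. u t * deriv \<phi> t) absolutely_integrable_on {a..b}"
proof -
  note sm = test_function_smooth[OF assms(1)]
  have zero: "\<phi> t = 0 \<and> deriv \<phi> t = 0" if "t \<notin> {a..b}" for t
    using test_function_zero[OF assms(1)] assms(2) that by blast
  have c: "continuous_on {a..b} \<phi>" "continuous_on {a..b} (deriv \<phi>)"
    using smooth_DERIV[OF sm] smooth_DERIV[OF smooth_deriv[OF sm]]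
    by (meson DERIV_isCont continuous_at_imp_continuous_on)+
  show 1: "(\<lambda>t. v t * \<phi> t) absolutely_integrable_on {a..b}"
    using abs_integrable_cont_mult[OF c(1) assms(5)] by (simp add: mult.commute)
  show 2: "(\<lambda>t. u t * deriv \<phi> t) absolutely_integrable_on {a..b}"
    by (intro absolutely_integrable_continuous_real continuous_intros c assms(4))
  have "(LINT t:I|lebesgue. u t * deriv \<phi> t) = (LINT t:{a..b}|lebesgue. u t * deriv \<phi> t)"
    "(LINT t:I|lebesgue. v t * \<phi> t) = (LINT t:{a..b}|lebesgue. v t * \<phi> t)"
    unfolding set_lebesgue_integral_def using zero assms(3)
    by (intro Bochner_Integration.integral_cong; force simp: indicator_def)+
  then show "(LINT t:I|lebesgue. u t * deriv \<phi> t) = integral {a..b} (\<lambda>t. u t * deriv \<phi> t)"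
    "(LINT t:I|lebesgue. v t * \<phi> t) = integral {a..b} (\<lambda>t. v t * \<phi> t)"
    using set_lebesgue_integral_eq_integral(2) 1 2 by auto
qed

lemma primitive_on_smooth:
  assumes "smooth \<phi>"
  shows "primitive_on \<phi> (deriv \<phi>) I"
  unfolding primitive_on_def
proof (intro allI impI conjI)
  fix a b :: real assume ab: "a \<le> b"
  show "deriv \<phi> absolutely_integrable_on {a..b}"
    using smooth_DERIV[OF smooth_deriv[OF assms]]
    by (meson DERIV_isCont continuous_at_imp_continuous_on absolutely_integrable_continuous_real)
  have "(deriv \<phi> has_integral \<phi> b - \<phi> a) {a..b}"
    using smooth_DERIV[OF assms] ab
    by (intro fundamental_theorem_of_calculus)
      (auto simp flip: has_real_derivative_iff_has_vector_derivative intro: has_field_derivative_at_within)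
  then show "\<phi> b - \<phi> a = integral {a..b} (deriv \<phi>)" by (simp add: integral_unique)
qed

text \<open>Integration by parts: the product rule is applied to \<open>u\<close> and
  \<open>\<phi>\<close> on an interval whose ends lie outside the support, so the boundary terms
  vanish.\<close>

lemma weak_derivative_of_primitive:
  assumes uv: "primitive_on u v I" and I: "open I" "is_interval I"
  shows "has_weak_derivative_on u v I"
  unfolding has_weak_derivative_on_def
proof (intro conjI allI impI)
  have "set_integrable lebesgue K u \<and> set_integrable lebesgue K v" if K: "compact K" "K \<subseteq> I" for K
  proof -
    obtain a b where ab: "K \<subseteq> {a<..<b}" "{a..b} \<subseteq> I" 
      using compact_in_open_interval[OF K I] .
    have K': "K \<in> sets lebesgue" "K \<subseteq> {a..b}" using K(1) ab(1) by (auto simp: compact_imp_closed)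
    have "v absolutely_integrable_on {a..b}"
    proof (cases "a \<le> b")
      case True
      then show ?thesis using primitive_onD(1)[OF uv _ ab(2)] by simp
    qed (auto simp: set_integrable_def)
    moreover have "u absolutely_integrable_on {a..b}"
      using primitive_on_continuous_Icc primitive_on_subset[OF uv ab(2)]
      by (intro absolutely_integrable_continuous_real) blast
    ultimately show ?thesis using set_integrable_subset K' by blast
  qed
  then show "locally_integrable_on u I" "locally_integrable_on v I"
    by (auto simp: locally_integrable_on_def)
  fix \<phi> assume \<phi>: "test_function I \<phi>"
  obtain a b where ab: "closure {x. \<phi> x \<noteq> 0} \<subseteq> {a<..<b}" "{a..b} \<subseteq> I"
    using compact_in_open_interval[OF _ _ I] \<phi> unfolding test_function_def by metis
  show "(LINT t:I|lebesgue. u t * deriv \<phi> t) = - (LINT t:I|lebesgue. v t * \<phi> t)"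
  proof (cases "a \<le> b")
    case True
    have v: "v absolutely_integrable_on {a..b}" using primitive_onD(1)[OF uv True ab(2)] .
    have u: "continuous_on {a..b} u"
      using primitive_on_continuous_Icc primitive_on_subset[OF uv ab(2)] by blast
    have s: "closure {x. \<phi> x \<noteq> 0} \<subseteq> {a..b}" using ab(1) by force
    note t = test_function_integral_Icc[OF \<phi> s ab(2) u v]
    have z: "\<phi> a = 0" "\<phi> b = 0"
      using ab(1) by (intro test_function_zero(1)[OF \<phi>]; auto)+
    have "u b * \<phi> b - u a * \<phi> a = integral {a..b} (\<lambda>t. u t * deriv \<phi> t + v t * \<phi> t)"
      using primitive_onD(3)[OF product_rule_primitive[OF uv primitive_on_smooth[OF test_function_smooth[OF \<phi>]]] True ab(2)] .
    also have "\<dots> = integral {a..b} (\<lambda>t. u t * deriv \<phi> t) + integral {a..b} (\<lambda>t. v t * \<phi> t)"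
      using t(3,4) by (intro integral_add abs_integrable_imp_integrable)
    finally show ?thesis using t(1,2) z by simp
  next
    case False
    then have "closure {x. \<phi> x \<noteq> 0} = {}" using ab(1) by auto
    then have "\<phi> t = 0 \<and> deriv \<phi> t = 0" for t using test_function_zero[OF \<phi>, of t] by auto
    then show ?thesis by (simp add: set_lebesgue_integral_def)
  qed
qed

text \<open>The derivative of the step rescaled to width \<open>h\<close> around \<open>a\<close> is
  nonnegative, vanishes off \<open>{a - h..a + h}\<close> and has integral 1. Integrating
  \<open>w\<close> against it yields a weighted mean of values close to \<open>w a\<close>.\<close>

lemma mollify_bound:
  fixes R w :: "real \<Rightarrow> real"
  assumes R: "smooth R" "\<And>x. 0 \<le> deriv R x" "\<And>x. x \<le> -1 \<Longrightarrow> R x = 0" "\<And>x. x \<ge> 1 \<Longrightarrow> R x = 1"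
    and h: "h > 0" "{a - h..a + h} \<subseteq> {p..q}"
    and w: "continuous_on {p..q} w" "\<And>t. \<bar>t - a\<bar> \<le> h \<Longrightarrow> \<bar>w t - w a\<bar> \<le> e"
  shows "\<bar>integral {p..q} (\<lambda>t. w t * deriv (\<lambda>t. R ((1 / h) * t + (- a / h))) t) - w a\<bar> \<le> e"
proof -
  define S where "S = (\<lambda>t. R ((1 / h) * t + (- a / h)))"
  have sm: "smooth S" unfolding S_def by (rule smooth_affine[OF R(1)])
  have S0: "S t = 0" if "t \<le> a - h" for t
    using that h(1) R(3) by (simp add: S_def field_simps)
  have S1: "S t = 1" if "t \<ge> a + h" for t
    using that h(1) R(4) by (simp add: S_def field_simps)
  have "(S has_real_derivative deriv R ((1 / h) * t + (- a / h)) * (1 / h)) (at t)" for t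
    unfolding S_def
    by (rule DERIV_chain2[OF smooth_DERIV[OF R(1)]]) (use h(1) in \<open>auto intro!: derivative_eq_intros\<close>)
  then have dS: "0 \<le> deriv S t" for t
    using R(2) h(1) by (metis DERIV_imp_deriv mult_nonneg_nonneg zero_le_divide_1_iff less_imp_le)
  have dS0: "deriv S t = 0" if "\<bar>t - a\<bar> > h" for t
  proof (cases "t < a")
    case True
    have "(S has_real_derivative 0) (at t)"
      by (rule has_field_derivative_transform_within_open[OF DERIV_const, of "{..<a - h}" _ 0])
        (use True that S0 in auto)
    then show ?thesis by (rule DERIV_imp_deriv)
  next
    case False
    have "(S has_real_derivative 0) (at t)"
      by (rule has_field_derivative_transform_within_open[OF DERIV_const, of "{a + h<..}" _ 1])
        (use False that S1 in auto)
    then show ?thesis by (rule DERIV_imp_deriv)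
  qed
  have pq: "p \<le> a - h" "a + h \<le> q" "p \<le> q" using h by auto
  have prim: "deriv S integrable_on {p..q}" "integral {p..q} (deriv S) = 1"
    using primitive_onD(2,3)[OF primitive_on_smooth[OF sm] pq(3) subset_UNIV] S0[OF pq(1)] S1[OF pq(2)]
    by auto
  have cS: "continuous_on {p..q} (deriv S)"
    using smooth_DERIV[OF smooth_deriv[OF sm]] by (meson DERIV_isCont continuous_at_imp_continuous_on)
  have i: "(\<lambda>t. w t * deriv S t) integrable_on {p..q}"
    by (intro integrable_continuous_real continuous_intros w(1) cS)
  have "integral {p..q} (\<lambda>t. w t * deriv S t) - w a = integral {p..q} (\<lambda>t. w t * deriv S t - w a * deriv S t)"
    using prim i by (subst integral_diff) (auto intro: integrable_on_mult_right)
  also have "norm \<dots> \<le> integral {p..q} (\<lambda>t. e * deriv S t)"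
  proof (rule integral_norm_bound_integral)
    show "(\<lambda>t. w t * deriv S t - w a * deriv S t) integrable_on {p..q}"
      by (intro integrable_diff i integrable_on_mult_right prim)
    show "(\<lambda>t. e * deriv S t) integrable_on {p..q}"
      by (intro integrable_on_mult_right prim)
    fix t
    show "norm (w t * deriv S t - w a * deriv S t) \<le> e * deriv S t"
    proof (cases "\<bar>t - a\<bar> \<le> h")
      case True
      then show ?thesis using w(2)[OF True] dS[of t]
        by (simp add: left_diff_distrib[symmetric] abs_mult mult_right_mono)
    qed (use dS0[of t] in simp)
  qed
  also have "\<dots> = e" using prim by simp
  finally show ?thesis unfolding S_def by simp
qed

text \<open>The lemma of du Bois-Reymond. With \<open>V\<close> an antiderivative of
  \<open>v\<close>, the difference \<open>w = u - V\<close> is orthogonal to derivatives of test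
  functions; one that rises near \<open>a\<close> and falls near \<open>b\<close> forces
  \<open>w a = w b\<close>.\<close>

lemma primitive_of_weak_derivative:
  assumes uv: "has_weak_derivative_on u v I" and u: "continuous_on I u" and I: "open I" "is_interval I"
  shows "primitive_on u v I"
  unfolding primitive_on_def
proof (intro allI impI conjI)
  fix a b :: real assume ab: "a \<le> b" "{a..b} \<subseteq> I"
  have v_int: "v absolutely_integrable_on {p..q}" if "{p..q} \<subseteq> I" for p q
    using uv that unfolding has_weak_derivative_on_def locally_integrable_on_def by blast
  then show "v absolutely_integrable_on {a..b}" using ab(2) .
  obtain p q where pq: "{a..b} \<subseteq> {p<..<q}" "{p..q} \<subseteq> I"
    using compact_in_open_interval[OF _ ab(2) I] by auto
  have pq': "p < a" "b < q" "p \<le> q" using pq(1) ab(1) by (auto simp: subset_iff)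
  have cu: "continuous_on {p..q} u" using u pq(2) continuous_on_subset by blast
  note v = v_int[OF pq(2)]
  define V where "V = (\<lambda>t. integral {p..t} v)"
  have pV: "primitive_on V v {p..q}"
    unfolding primitive_on_def
  proof (intro allI impI conjI)
    fix s t :: real assume st: "s \<le> t" "{s..t} \<subseteq> {p..q}"
    then show "v absolutely_integrable_on {s..t}" using v_int pq(2) by blast
    have "v integrable_on {p..t}"
      using st by (intro abs_integrable_imp_integrable v_int order_trans[OF _ pq(2)]) auto
    then show "V t - V s = integral {s..t} v"
      unfolding V_def using integral_split_Icc[of v p t s] st by auto
  qed
  have cV: "continuous_on {p..q} V" by (rule primitive_on_continuous_Icc[OF pV])
  define w where "w = (\<lambda>t. u t - V t)"
  have cw: "continuous_on {p..q} w" unfolding w_def by (intro continuous_intros cu cV)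
  obtain R where R: "smooth R" "\<And>x. 0 \<le> deriv R x" "\<And>x. x \<le> -1 \<Longrightarrow> R x = 0" "\<And>x. x \<ge> 1 \<Longrightarrow> R x = 1"
    using smooth_step_exists by metis
  have "\<bar>w a - w b\<bar> \<le> 2 * e" if e: "e > 0" for e
  proof -
    obtain d where d: "d > 0" "\<And>x y. x \<in> {p..q} \<Longrightarrow> y \<in> {p..q} \<Longrightarrow> \<bar>x - y\<bar> < d \<Longrightarrow> \<bar>w x - w y\<bar> < e"
      using compact_uniformly_continuous[OF cw] e unfolding uniformly_continuous_on_def dist_real_def
      by (metis abs_minus_commute compact_Icc)
    \<comment> \<open>The width lies below the modulus of continuity of \<open>w\<close>, and both
      transition zones stay inside the enlarged interval \<open>{p..q}\<close>.\<close>
    define h where "h = min (d / 2) (min (a - p) (q - b))"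
    have h: "h > 0" "h < d" "h \<le> a - p" "h \<le> q - b" using d(1) pq' by (auto simp: h_def)
    define S where "S = (\<lambda>c t. R ((1 / h) * t + (- c / h)))"
    have smS: "smooth (S c)" for c unfolding S_def by (rule smooth_affine[OF R(1)])
    have mol: "\<bar>integral {p..q} (\<lambda>t. w t * deriv (S c) t) - w c\<bar> \<le> e" if "c \<in> {a..b}" for c
      unfolding S_def
    proof (rule mollify_bound[OF R h(1) _ cw])
      show "{c - h..c + h} \<subseteq> {p..q}" using h that by auto
      show "\<bar>w t - w c\<bar> \<le> e" if "\<bar>t - c\<bar> \<le> h" for t
      proof -
        have "\<bar>w t - w c\<bar> < e" using h that \<open>c \<in> {a..b}\<close> pq' by (intro d(2)) auto
        then show ?thesis by simp
      qed
    qed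
    \<comment> \<open>A smoothed indicator of \<open>{a..b}\<close>. Its derivative is an
      approximate point mass at \<open>a\<close> minus one at \<open>b\<close>, so its vanishing
      integral against \<open>w\<close> lies within \<open>2 * e\<close> of
      \<open>w a - w b\<close>.\<close>
    define \<phi> where "\<phi> = (\<lambda>t. S a t - S b t)"
    have sm\<phi>: "smooth \<phi>" unfolding \<phi>_def by (intro smooth_diff smS)
    have "\<phi> t = 0" if "t \<notin> {a - h..b + h}" for t
      using that h(1) ab(1) R(3,4) by (auto simp: \<phi>_def S_def field_simps not_le)
    then have "closure {x. \<phi> x \<noteq> 0} \<subseteq> {a - h..b + h}"
      by (intro closure_minimal) blast+
    then have s: "closure {x. \<phi> x \<noteq> 0} \<subseteq> {p..q}" using h by auto
    have "bounded {x. \<phi> x \<noteq> 0}"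
      using bounded_subset[OF bounded_closed_interval subset_trans[OF closure_subset s]] .
    then have \<phi>: "test_function I \<phi>"
      using sm\<phi> s pq(2) by (auto simp: test_function_def smooth_def)
    have \<phi>pq: "\<phi> p = 0" "\<phi> q = 0"
      using h pq' ab(1) R(3,4) by (auto simp: \<phi>_def S_def field_simps)
    note t = test_function_integral_Icc[OF \<phi> s pq(2) cu v] test_function_integral_Icc[OF \<phi> s pq(2) cV v]
    have "integral {p..q} (\<lambda>t. u t * deriv \<phi> t) = - integral {p..q} (\<lambda>t. v t * \<phi> t)"
      using uv \<phi> t(1,2) unfolding has_weak_derivative_on_def by metis
    moreover have "0 = integral {p..q} (\<lambda>t. V t * deriv \<phi> t + v t * \<phi> t)"
      using primitive_onD(3)[OF product_rule_primitive[OF pV primitive_on_smooth[OF sm\<phi>]] pq'(3) subset_refl]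
        \<phi>pq by simp
    moreover have "\<dots> = integral {p..q} (\<lambda>t. V t * deriv \<phi> t) + integral {p..q} (\<lambda>t. v t * \<phi> t)"
      using t(7,8) by (intro integral_add abs_integrable_imp_integrable)
    ultimately have "0 = integral {p..q} (\<lambda>t. u t * deriv \<phi> t) - integral {p..q} (\<lambda>t. V t * deriv \<phi> t)"
      by simp
    also have "\<dots> = integral {p..q} (\<lambda>t. u t * deriv \<phi> t - V t * deriv \<phi> t)"
      using t(4,8) by (intro integral_diff[symmetric] abs_integrable_imp_integrable)
    also have "\<dots> = integral {p..q} (\<lambda>t. w t * deriv (S a) t - w t * deriv (S b) t)"
    proof -
      have "deriv \<phi> t = deriv (S a) t - deriv (S b) t" for t
        unfolding \<phi>_def by (intro DERIV_imp_deriv DERIV_diff smooth_DERIV smS)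
      then have "u t * deriv \<phi> t - V t * deriv \<phi> t = w t * deriv (S a) t - w t * deriv (S b) t" for t
        by (simp only: w_def) (simp add: algebra_simps)
      then show ?thesis by simp
    qed
    also have "\<dots> = integral {p..q} (\<lambda>t. w t * deriv (S a) t) - integral {p..q} (\<lambda>t. w t * deriv (S b) t)"
    proof -
      have "continuous_on {p..q} (deriv (S c))" for c
        using smooth_DERIV[OF smooth_deriv[OF smS]] by (meson DERIV_isCont continuous_at_imp_continuous_on)
      then show ?thesis
        by (intro integral_diff integrable_continuous_real continuous_intros cw) auto
    qed
    finally show ?thesis using mol[of a] mol[of b] ab(1) by (auto simp: abs_le_iff)
  qed
  then have "\<bar>w a - w b\<bar> \<le> 0" using field_le_epsilon[of "\<bar>w a - w b\<bar>" 0]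
    by (metis add_0 field_sum_of_halves mult_2 half_gt_zero)
  then have "u b - u a = V b - V a" by (simp add: w_def)
  then show "u b - u a = integral {a..b} v"
    using primitive_onD(3)[OF pV ab(1)] pq' by auto
qed

subsection \<open>Locally square integrable functions\<close>

text \<open>The sets over which \<open>f\<close> integrates to 0 include the closed intervals and
  are stable under complements and countable disjoint unions. By the pi-lambda principle they
  include all Borel sets, and then all Lebesgue sets, which differ by null sets. The choices
  \<open>{t. 0 < f t}\<close> and \<open>{t. f t < 0}\<close> finish the proof.\<close>

lemma AE_zero_of_integrals_zero:
  fixes w :: "real \<Rightarrow> real"
  assumes w: "w absolutely_integrable_on {a..b}"
    and z: "\<And>s t. s \<le> t \<Longrightarrow> {s..t} \<subseteq> {a..b} \<Longrightarrow> integral {s..t} w = 0"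
  shows "AE t in lebesgue. t \<in> {a..b} \<longrightarrow> w t = 0"
proof -
  define f where "f = (\<lambda>t. indicator {a..b} t *\<^sub>R w t)"
  have f: "integrable lebesgue f" using w by (simp add: f_def set_integrable_def)
  have fA: "set_integrable lebesgue A f" if "A \<in> sets lebesgue" for A
    using integrable_mult_indicator[OF that f] by (simp add: set_integrable_def)
  \<comment> \<open>Cutting with \<open>{a..b}\<close> turns a closed interval into a subinterval,
    to which \<open>z\<close> applies, or into the empty set.\<close>
  have Icc: "(LINT t:{p..q}|lebesgue. f t) = 0" for p q
  proof -
    have "(LINT t:{p..q}|lebesgue. f t) = (LINT t:{max a p..min b q}|lebesgue. w t)"
      unfolding set_lebesgue_integral_def f_def
      by (intro Bochner_Integration.integral_cong) (auto simp: indicator_def)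
    also have "\<dots> = integral {max a p..min b q} w"
      by (intro set_lebesgue_integral_eq_integral(2) set_integrable_subset[OF w]) auto
    also have "\<dots> = 0"
    proof (cases "max a p \<le> min b q")
      case True
      then show ?thesis by (intro z) auto
    qed simp
    finally show ?thesis .
  qed
  have all: "(LINT t|lebesgue. f t) = 0"
  proof -
    have "(LINT t|lebesgue. f t) = (LINT t:{a..b}|lebesgue. f t)"
      unfolding set_lebesgue_integral_def f_def
      by (intro Bochner_Integration.integral_cong) (auto simp: indicator_def)
    then show ?thesis using Icc by simp
  qed
  have borel: "(LINT t:A|lebesgue. f t) = 0" if "A \<in> sets borel" for A
  proof -
    let ?G = "range (\<lambda>(p, q). {p..q::real})"
    have "Int_stable ?G" unfolding Int_stable_def by (force intro: rev_image_eqI)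
    moreover have "?G \<subseteq> Pow UNIV" by simp
    moreover have "A \<in> sigma_sets UNIV ?G"
      using that by (simp add: borel_eq_atLeastAtMost)
    ultimately show ?thesis
    proof (induction rule: sigma_sets_induct_disjoint)
      case (basic A)
      then show ?case using Icc by auto
    next
      case empty
      show ?case unfolding set_lebesgue_integral_def by simp
    next
      case (compl A)
      then have A: "A \<in> sets lebesgue" by (simp add: borel_eq_atLeastAtMost)
      have A': "UNIV - A \<in> sets lebesgue" using sets.compl_sets[OF A] by simp
      have "(LINT t:UNIV - A|lebesgue. f t) + (LINT t:A|lebesgue. f t) = (LINT t:(UNIV - A) \<union> A|lebesgue. f t)"
        by (rule set_integral_Un[symmetric]) (use A' A fA in auto)
      also have "\<dots> = 0" using all by (simp add: set_lebesgue_integral_def)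
      finally show ?case using compl by simp
    next
      case (union A)
      have A: "A i \<in> sets lebesgue" for i
      proof -
        have "A i \<in> sigma_sets UNIV ?G" using union(2) by blast
        then show ?thesis by (simp add: borel_eq_atLeastAtMost)
      qed
      have "(LINT t:(\<Union>i. A i)|lebesgue. f t) = (\<Sum>i. (LINT t:(A i)|lebesgue. f t))"
        by (rule lebesgue_integral_countable_add)
          (use A union(1) fA in \<open>auto simp: disjoint_family_on_def\<close>)
      then show ?case using union(3) by simp
    qed
  qed
  have "(LINT t:A|lebesgue. f t) = 0" if A: "A \<in> sets lebesgue" for A
  proof -
    obtain S N N' where S: "A = S \<union> N" "N \<subseteq> N'" "N' \<in> null_sets lborel" "S \<in> sets lborel"
      using sets_completionE[OF A] .
    have "(LINT t:A|lebesgue. f t) = (LINT t:S|lebesgue. f t)"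
    proof (rule set_integral_cong_set)
      show "set_borel_measurable lebesgue S f" "set_borel_measurable lebesgue A f"
        using fA[of S] fA[OF A] S(4) by (auto simp: set_borel_measurable_def set_integrable_def)
      have "N' \<in> null_sets lebesgue" using S(3) by (rule null_sets_completionI)
      then show "AE x in lebesgue. x \<in> S \<longleftrightarrow> x \<in> A"
        by (rule AE_I') (use S in auto)
    qed
    then show ?thesis using borel[of S] S(4) by simp
  qed
  note all_sets = this
  have [measurable]: "f \<in> borel_measurable lebesgue" using f by auto
  have sets: "{t. 0 < f t} \<in> sets lebesgue" "{t. f t < 0} \<in> sets lebesgue"
    using measurable_sets[of f lebesgue borel "{0<..}"] measurable_sets[of f lebesgue borel "{..<0}"]
    by (auto simp: vimage_def)
  have sgn: "AE t in lebesgue. e * f t \<le> 0" if e: "{t. 0 < e * f t} \<in> sets lebesgue" for e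
  proof -
    let ?h = "\<lambda>t. e * (indicator {t. 0 < e * f t} t *\<^sub>R f t)"
    have "integrable lebesgue ?h" using fA[OF e] by (auto simp: set_integrable_def)
    moreover have "(LINT t|lebesgue. ?h t) = 0"
      using all_sets[OF e] by (simp add: set_lebesgue_integral_def)
    moreover have "0 \<le> ?h t" for t by (simp add: indicator_def)
    ultimately have "AE t in lebesgue. ?h t = 0" using integral_nonneg_eq_0_iff_AE[of lebesgue ?h] by simp
    then show ?thesis by eventually_elim (auto simp: indicator_def split: if_splits)
  qed
  have "AE t in lebesgue. f t = 0"
    using sgn[of 1] sgn[of "-1"] sets by (auto elim: eventually_elim2)
  then show ?thesis by eventually_elim (auto simp: f_def)
qed

lemma locally_L2_on_mult:
  assumes "locally_L2_on v I" "locally_L2_on w I" "{a..b} \<subseteq> I"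
  shows "(\<lambda>t. v t * w t) absolutely_integrable_on {a..b}"
proof (rule measurable_bounded_by_integrable_imp_absolutely_integrable)
  have i: "v absolutely_integrable_on {a..b}" "w absolutely_integrable_on {a..b}"
    "(\<lambda>t. (v t)\<^sup>2) integrable_on {a..b}" "(\<lambda>t. (w t)\<^sup>2) integrable_on {a..b}"
    using assms unfolding locally_L2_on_def by (auto intro: abs_integrable_imp_integrable)
  show "(\<lambda>t. v t * w t) \<in> borel_measurable (lebesgue_on {a..b})"
    using i(1,2) by (intro borel_measurable_times absolutely_integrable_imp_borel_measurable) auto
  show "(\<lambda>t. (v t)\<^sup>2 + (w t)\<^sup>2) integrable_on {a..b}" using i(3,4) by (rule integrable_add)
  fix t
  have "2 * \<bar>v t * w t\<bar> \<le> (v t)\<^sup>2 + (w t)\<^sup>2"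
    using sum_squares_bound[of "\<bar>v t\<bar>" "\<bar>w t\<bar>"] by (simp add: abs_mult)
  then show "norm (v t * w t) \<le> (v t)\<^sup>2 + (w t)\<^sup>2" by simp
qed simp

lemma locally_L2_on_lin:
  assumes "locally_L2_on v I" "locally_L2_on w I"
  shows "locally_L2_on (\<lambda>t. p * v t + q * w t) I"
  unfolding locally_L2_on_def
proof (intro allI impI conjI)
  fix a b assume ab: "{a..b} \<subseteq> I"
  have i: "v absolutely_integrable_on {a..b}" "w absolutely_integrable_on {a..b}"
    "(\<lambda>t. (v t)\<^sup>2) absolutely_integrable_on {a..b}" "(\<lambda>t. (w t)\<^sup>2) absolutely_integrable_on {a..b}"
    using assms ab unfolding locally_L2_on_def by auto
  show "(\<lambda>t. p * v t + q * w t) absolutely_integrable_on {a..b}"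
    by (intro set_integral_add(1) set_integrable_mult_right i)
  have "(\<lambda>t. p\<^sup>2 * (v t)\<^sup>2 + (2 * p * q) * (v t * w t) + q\<^sup>2 * (w t)\<^sup>2) absolutely_integrable_on {a..b}"
    by (intro set_integral_add(1) set_integrable_mult_right i locally_L2_on_mult[OF assms ab])
  then show "(\<lambda>t. (p * v t + q * w t)\<^sup>2) absolutely_integrable_on {a..b}"
    by (simp add: power2_sum power_mult_distrib algebra_simps)
qed

lemma locally_L2_on_continuous:
  assumes "continuous_on I h"
  shows "locally_L2_on h I"
  unfolding locally_L2_on_def
  using assms continuous_on_subset
  by (blast intro: absolutely_integrable_continuous_real continuous_on_power)

lemma locally_L2_on_subset: "locally_L2_on v I \<Longrightarrow> J \<subseteq> I \<Longrightarrow> locally_L2_on v J"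
  unfolding locally_L2_on_def by blast

section \<open>Time shifts, concatenation and changes on null sets\<close>

lemma abs_integrable_shift:
  fixes v :: "real \<Rightarrow> real"
  assumes "v absolutely_integrable_on {a - 1..b - 1}"
  shows "(\<lambda>t. v (t - 1)) absolutely_integrable_on {a..b}"
  using assms integrable_shift_real_ivl[where a = "a - 1" and b = "b - 1" and c = "-1" and f = v]
    integrable_shift_real_ivl[where a = "a - 1" and b = "b - 1" and c = "-1" and f = "\<lambda>t. \<bar>v t\<bar>"]
  by (simp add: absolutely_integrable_on_def)

lemma integral_shift_one:
  fixes v :: "real \<Rightarrow> real"
  shows "integral {a..b} (\<lambda>t. v (t - 1)) = integral {a - 1..b - 1} v"
  using integral_shift_real_ivl[where a = "a - 1" and b = "b - 1" and c = "-1" and f = v] by simp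

lemma locally_L2_on_shift:
  assumes "locally_L2_on v {p - 1..q - 1}"
  shows "locally_L2_on (\<lambda>t. v (t - 1)) {p..q}"
  unfolding locally_L2_on_def
proof (intro allI impI)
  fix a b assume "{a..b} \<subseteq> {p..q}"
  then have "{a - 1..b - 1} \<subseteq> {p - 1..q - 1}" by auto
  then show "(\<lambda>t. v (t - 1)) absolutely_integrable_on {a..b} \<and>
      (\<lambda>t. (v (t - 1))\<^sup>2) absolutely_integrable_on {a..b}"
    using assms abs_integrable_shift[of a b v] abs_integrable_shift[of a b "\<lambda>t. (v t)\<^sup>2"]
    unfolding locally_L2_on_def by blast
qed

lemma locally_L2_on_Icc:
  "locally_L2_on v {p..q} \<longleftrightarrow>
     v absolutely_integrable_on {p..q} \<and> (\<lambda>t. (v t)\<^sup>2) absolutely_integrable_on {p..q}"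
  unfolding locally_L2_on_def using absolutely_integrable_on_subinterval by blast

lemma locally_L2_on_combine:
  assumes "locally_L2_on v {p..q}" "locally_L2_on v {q..r}" "p \<le> q" "q \<le> r"
  shows "locally_L2_on v {p..r}"
  using assms absolutely_integrable_on_combine unfolding locally_L2_on_Icc by blast

lemma locally_L2_on_spike:
  assumes "locally_L2_on v {p..q}" "negligible N" "\<And>t. t \<in> {p..q} - N \<Longrightarrow> w t = v t"
  shows "locally_L2_on w {p..q}"
  using assms absolutely_integrable_spike[where f = v and T = "{p..q}" and S = N and g = w]
    absolutely_integrable_spike[where f = "\<lambda>t. (v t)\<^sup>2" and T = "{p..q}" and S = N and g = "\<lambda>t. (w t)\<^sup>2"]
  unfolding locally_L2_on_Icc by simp

subsection \<open>Solutions of the neutral equation\<close>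

lemma AE_lebesgue_iff_negligible: "(AE t in lebesgue. P t) \<longleftrightarrow> (\<exists>N. negligible N \<and> (\<forall>t. t \<notin> N \<longrightarrow> P t))"
  unfolding eventually_ae_filter_negligible by (metis (mono_tags, lifting) mem_Collect_eq subsetI subsetD)

lemma primitive_on_unique_derivative:
  assumes "primitive_on u v {a..b}" "primitive_on u v' {a..b}"
  obtains N where "negligible N" "\<And>t. t \<in> {a..b} - N \<Longrightarrow> v t = v' t"
proof (cases "a \<le> b")
  case True
  have d: "primitive_on (\<lambda>t. 1 * u t + (-1) * u t) (\<lambda>t. 1 * v t + (-1) * v' t) {a..b}"
    by (rule primitive_on_lin[OF assms])
  have "AE t in lebesgue. t \<in> {a..b} \<longrightarrow> 1 * v t + (-1) * v' t = 0"
  proof (rule AE_zero_of_integrals_zero)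
    show "(\<lambda>t. 1 * v t + (-1) * v' t) absolutely_integrable_on {a..b}"
      by (rule primitive_onD(1)[OF d True subset_refl])
    show "integral {s..t} (\<lambda>t. 1 * v t + (-1) * v' t) = 0" if "s \<le> t" "{s..t} \<subseteq> {a..b}" for s t
      using primitive_onD(3)[OF d that] by simp
  qed
  then obtain N where "negligible N" "\<And>t. t \<notin> N \<Longrightarrow> t \<in> {a..b} \<longrightarrow> 1 * v t + (-1) * v' t = 0"
    unfolding AE_lebesgue_iff_negligible by metis
  then show thesis using that[of N] by auto
next
  case False
  then show thesis using that[of "{}"] by auto
qed

text \<open>Square integrability is granted on each bounded piece only for some weak derivative
  \<open>v'\<close> chosen there. Both \<open>v\<close> and \<open>v'\<close> have \<open>y\<close>
  as primitive, so they agree almost everywhere and \<open>v\<close> inherits the property.\<close>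

lemma H1_loc_weak_derivative:
  assumes y: "y \<in> H1_loc {-1<..}" and v: "has_weak_derivative_on y v {-1<..}"
  shows "primitive_on y v {-1<..}" "locally_L2_on v {-1<..}"
proof -
  have ball: "y \<in> H1 {p<..<q}" if "-1 < p" for p q
  proof -
    have "closure {p<..<q} \<subseteq> {p..q}" by (intro closure_minimal) auto
    then have "closure {p<..<q} \<subseteq> {-1<..}" using that by force
    moreover have "compact (closure {p<..<q})" by simp
    ultimately show ?thesis using y open_greaterThanLessThan by (simp add: H1_loc_def)
  qed
  have "isCont y t" if t: "-1 < t" for t
  proof -
    have "continuous_on {(t - 1) / 2<..<t + 1} y" using ball[of "(t - 1) / 2" "t + 1"] t by (simp add: H1_def)
    then show ?thesis using t by (simp add: continuous_on_eq_continuous_at)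
  qed
  then have "continuous_on {-1<..} y" by (simp add: continuous_at_imp_continuous_on)
  then show prim: "primitive_on y v {-1<..}"
    by (intro primitive_of_weak_derivative v) (auto simp: is_interval_1)
  have "locally_L2_on v {a..b}" if ab: "a \<le> b" "{a..b} \<subseteq> {-1<..}" for a b
  proof -
    have a: "-1 < a" using ab by (auto simp: subset_iff)
    \<comment> \<open>\<open>(a - 1) / 2\<close> is the midpoint of -1 and \<open>a\<close>: it
      leaves a margin to the left of \<open>a\<close> and still stays away from -1.\<close>
    define U where "U = {(a - 1) / 2<..<b + 1}"
    have sub: "{a..b} \<subseteq> U" using a by (auto simp: U_def field_simps)
    have "y \<in> H1 U" unfolding U_def using a by (intro ball) simp
    then obtain v' where v': "continuous_on U y" "has_weak_derivative_on y v' U" "square_integrable_on v' U"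
      by (auto simp: H1_def)
    have "primitive_on y v' U"
      by (rule primitive_of_weak_derivative[OF v'(2,1)]) (auto simp: U_def is_interval_1)
    then obtain N where N: "negligible N" "\<And>t. t \<in> {a..b} - N \<Longrightarrow> v t = v' t"
      using primitive_on_unique_derivative primitive_on_subset prim ab(2) sub by metis
    have "v' absolutely_integrable_on {a..b}"
      using v'(2) sub unfolding has_weak_derivative_on_def locally_integrable_on_def by auto
    moreover have "(\<lambda>t. (v' t)\<^sup>2) absolutely_integrable_on {a..b}"
      using v'(3) sub set_integrable_subset unfolding square_integrable_on_def by fastforce
    ultimately show ?thesis using locally_L2_on_spike[OF _ N] by (simp add: locally_L2_on_Icc)
  qed
  then show "locally_L2_on v {-1<..}"
    unfolding locally_L2_on_def by (metis absolutely_integrable_negligible atLeastatMost_empty_iff2 negligible_empty subset_refl)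
qed

lemma square_integrable_on_of_locally_L2:
  assumes "locally_L2_on w I" "{a..b} \<subseteq> I" "U \<subseteq> {a..b}" "U \<in> sets lebesgue"
  shows "square_integrable_on w U"
proof -
  have "set_integrable lebesgue U w" "set_integrable lebesgue U (\<lambda>t. (w t)\<^sup>2)"
    using assms set_integrable_subset unfolding locally_L2_on_def by blast+
  then show ?thesis
    by (simp add: square_integrable_on_def set_integrable_def set_borel_measurable_def)
qed

lemma H1_loc_of_primitive:
  assumes uv: "primitive_on u v I" and v: "locally_L2_on v I" and I: "open I" "is_interval I"
  shows "u \<in> H1_loc I"
  unfolding H1_loc_def
proof (intro CollectI allI impI)
  fix U :: "real set" assume U: "open U \<and> compact (closure U) \<and> closure U \<subseteq> I"
  obtain a b where ab: "closure U \<subseteq> {a<..<b}" "{a..b} \<subseteq> I"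
    using compact_in_open_interval[OF _ _ I] U by metis
  have UI: "U \<subseteq> I" "U \<subseteq> {a..b}" using U ab(1) closure_subset[of U] by (force)+
  have Us: "U \<in> sets lebesgue" using U by auto
  have u: "continuous_on I u" by (rule primitive_on_continuous[OF uv I(1)])
  have "square_integrable_on u U" "square_integrable_on v U"
    using square_integrable_on_of_locally_L2[OF _ ab(2) UI(2) Us] locally_L2_on_continuous[OF u] v by blast+
  moreover have "has_weak_derivative_on u v U"
    using has_weak_derivative_on_subset[OF weak_derivative_of_primitive[OF uv I] UI(1)] .
  ultimately show "u \<in> H1 U"
    using continuous_on_subset[OF u UI(1)] by (auto simp: H1_def)
qed

text \<open>The form in which solutions are handled from here on: one and the same \<open>v\<close>
  is the derivative, is locally square integrable and satisfies the equation off a null set.\<close>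

lemma neutral_solution_iff:
  "neutral_solution c f g D y0 y \<longleftrightarrow>
     (\<exists>v N. primitive_on y v {-1<..} \<and> locally_L2_on v {-1<..} \<and> negligible N \<and>
        (\<forall>t. t > 0 \<longrightarrow> t \<notin> N \<longrightarrow> v t + c * v (t - 1) + f (y t) + g (y (t - 1)) = D)) \<and>
     (\<forall>t\<in>{-1<..<0}. y t = y0 t)" (is "_ \<longleftrightarrow> ?E \<and> _")
proof -
  have I: "open {-1::real<..}" "is_interval {-1::real<..}" by (auto simp: is_interval_1)
  have "y \<in> H1_loc {-1<..} \<and>
     (\<exists>v. has_weak_derivative_on y v {-1<..} \<and>
          (AE t in lebesgue. t > 0 \<longrightarrow> v t + c * v (t - 1) + f (y t) + g (y (t - 1)) = D)) \<longleftrightarrow> ?E"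
    unfolding AE_lebesgue_iff_negligible
    using H1_loc_weak_derivative H1_loc_of_primitive[OF _ _ I] weak_derivative_of_primitive[OF _ I]
    by metis
  then show ?thesis unfolding neutral_solution_def by blast
qed

text \<open>On a time step of length 1 the delayed terms of two solutions cancel. Their difference
  then has derivative \<open>- h\<close>, where \<open>\<delta> * h\<close> is nonnegative because
  \<open>f\<close> is monotone, so \<open>\<delta>\<^sup>2\<close> cannot grow.\<close>

lemma neutral_solution_unique:
  fixes f g :: "real \<Rightarrow> real"
  assumes f: "mono f" "continuous_on UNIV f" and g: "continuous_on UNIV g"
    and y: "neutral_solution c f g D y0 y" and z: "neutral_solution c f g D y0 z"
    and t: "-1 < t"
  shows "y t = z t"
proof -
  obtain v N where v: "primitive_on y v {-1<..}" "negligible N"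
      "\<And>t. t > 0 \<Longrightarrow> t \<notin> N \<Longrightarrow> v t + c * v (t - 1) + f (y t) + g (y (t - 1)) = D"
    using y unfolding neutral_solution_iff by metis
  obtain w M where w: "primitive_on z w {-1<..}" "negligible M"
      "\<And>t. t > 0 \<Longrightarrow> t \<notin> M \<Longrightarrow> w t + c * w (t - 1) + f (z t) + g (z (t - 1)) = D"
    using z unfolding neutral_solution_iff by metis
  define \<delta> where "\<delta> = (\<lambda>t. 1 * y t + (-1) * z t)"
  define x where "x = (\<lambda>t. 1 * v t + (-1) * w t)"
  have \<delta>: "primitive_on \<delta> x {-1<..}" unfolding \<delta>_def x_def by (rule primitive_on_lin[OF v(1) w(1)])
  have cont: "continuous_on {-1<..} y" "continuous_on {-1<..} z"
    by (auto intro: primitive_on_continuous v(1) w(1))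
  then have c\<delta>: "continuous_on {-1<..} \<delta>" unfolding \<delta>_def by (intro continuous_intros)
  define h where "h = (\<lambda>t. f (y t) - f (z t))"
  have ch: "continuous_on {-1<..} h" unfolding h_def
    by (intro continuous_on_diff continuous_on_compose2[OF f(2)] cont) auto
  have close: "\<delta> t = 0" if st: "\<And>r. r \<in> {-1<..t - 1} \<Longrightarrow> \<delta> r = 0"
      and lim: "0 \<le> p" "p < t" "\<delta> p = 0" for t p
  proof -
    \<comment> \<open>The interval is open at \<open>p\<close>: with \<open>p = 0\<close> included,
      the shifted interval would start at -1, outside the domain of the solutions.\<close>
    have prim: "primitive_on \<delta> (\<lambda>t. - h t) {p<..t}"
      unfolding primitive_on_def
    proof (intro allI impI conjI)
      fix a b assume ab: "a \<le> b" "{a..b} \<subseteq> {p<..t}"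
      have ab': "p < a" "b \<le> t" "0 < a" using ab lim(1) by (auto simp: subset_iff)
      have sub: "{a..b} \<subseteq> {-1<..}" "{a - 1..b - 1} \<subseteq> {-1<..}" using ab' by auto
      have ih: "h integrable_on {a..b}" "(\<lambda>t. - h t) absolutely_integrable_on {a..b}"
        using sub(1) by (auto intro!: integrable_continuous_real absolutely_integrable_continuous_real
            continuous_intros intro: continuous_on_subset[OF ch])
      then show "(\<lambda>t. - h t) absolutely_integrable_on {a..b}" by simp
      have ix: "x integrable_on {a..b}" "integral {a..b} x = \<delta> b - \<delta> a"
        using primitive_onD[OF \<delta> ab(1) sub(1)] by auto
      have ix': "(\<lambda>t. x (t - 1)) integrable_on {a..b}" "integral {a..b} (\<lambda>t. x (t - 1)) = 0"
      proof -
        have "x absolutely_integrable_on {a - 1..b - 1}" "integral {a - 1..b - 1} x = \<delta> (b - 1) - \<delta> (a - 1)"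
          using primitive_onD[OF \<delta> _ sub(2)] ab(1) by auto
        moreover have "\<delta> (b - 1) = 0" "\<delta> (a - 1) = 0" using ab ab' by (auto intro!: st)
        ultimately show "(\<lambda>t. x (t - 1)) integrable_on {a..b}" "integral {a..b} (\<lambda>t. x (t - 1)) = 0"
          using abs_integrable_shift abs_integrable_imp_integrable by (auto simp: integral_shift_one)
      qed
      have "integral {a..b} (\<lambda>t. x t + c * x (t - 1) + h t) = integral {a..b} (\<lambda>t. 0)"
      proof (rule integral_spike[OF negligible_Un[OF v(2) w(2)]])
        fix r assume r: "r \<in> {a..b} - (N \<union> M)"
        then have "r > 0" using ab'(3) by auto
        moreover have "\<delta> (r - 1) = 0" using r ab' by (intro st) auto
        then have "y (r - 1) = z (r - 1)" by (simp add: \<delta>_def)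
        ultimately show "0 = x r + c * x (r - 1) + h r"
          using v(3)[of r] w(3)[of r] r unfolding x_def h_def by (simp add: algebra_simps)
      qed
      moreover have "integral {a..b} (\<lambda>t. x t + c * x (t - 1) + h t)
          = integral {a..b} x + c * integral {a..b} (\<lambda>t. x (t - 1)) + integral {a..b} h"
        using ix(1) ix'(1) ih(1) by (subst integral_add; (intro integrable_add integrable_on_mult_right)?; simp?)
           (subst integral_add; (intro integrable_on_mult_right)?; simp)
      ultimately show "\<delta> b - \<delta> a = integral {a..b} (\<lambda>t. - h t)"
        using ix(2) ix'(2) by simp
    qed
    have sq: "primitive_on (\<lambda>t. \<delta> t * \<delta> t) (\<lambda>t. \<delta> t * (- h t) + (- h t) * \<delta> t) {p<..t}"
      by (rule product_rule_primitive[OF prim prim])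
    have le: "\<delta> t * \<delta> t \<le> \<delta> s * \<delta> s" if s: "p < s" "s \<le> t" for s
    proof -
      have "\<delta> t * \<delta> t - \<delta> s * \<delta> s = integral {s..t} (\<lambda>t. \<delta> t * (- h t) + (- h t) * \<delta> t)"
        by (rule primitive_onD(3)[OF sq]) (use s in auto)
      also have "\<dots> \<le> integral {s..t} (\<lambda>_. 0)"
      proof (rule integral_le)
        show "(\<lambda>t. \<delta> t * (- h t) + (- h t) * \<delta> t) integrable_on {s..t}"
          by (rule primitive_onD(2)[OF sq]) (use s in auto)
        fix r
        have "0 \<le> \<delta> r * h r"
        proof (cases "y r \<le> z r")
          case True
          then show ?thesis using f(1) by (auto simp: \<delta>_def h_def mono_def intro: mult_nonpos_nonpos)
        next
          case False
          then show ?thesis using f(1) by (auto simp: \<delta>_def h_def mono_def)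
        qed
        then show "\<delta> r * (- h r) + (- h r) * \<delta> r \<le> 0" by (simp add: mult.commute)
      qed (rule integrable_0)
      finally show ?thesis by simp
    qed
    \<comment> \<open>The decay of \<open>\<delta>\<^sup>2\<close> is known from times
      \<open>s > p\<close> only, so the comparison with \<open>p\<close> itself is a limit from the
      right.\<close>
    have "(\<delta> \<longlongrightarrow> \<delta> p) (at p)"
      using c\<delta> lim(1) by (simp add: continuous_on_eq_continuous_at isCont_def)
    then have "((\<lambda>s. \<delta> s * \<delta> s) \<longlongrightarrow> \<delta> p * \<delta> p) (at_right p)"
      by (intro tendsto_mult) (auto intro: tendsto_mono[OF at_le])
    moreover have "\<forall>\<^sub>F s in at_right p. \<delta> t * \<delta> t \<le> \<delta> s * \<delta> s"
      using eventually_at_right_real[OF lim(2)] by eventually_elim (auto intro: le)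
    ultimately have "\<delta> t * \<delta> t \<le> \<delta> p * \<delta> p" by (rule tendsto_lowerbound) simp
    then show ?thesis using lim(3) by (metis mult_eq_0_iff mult_zero_left not_square_less_zero order_antisym_conv linorder_not_less)
  qed
  have neg: "\<delta> t = 0" if "-1 < t" "t < 0" for t
    using that y z unfolding neutral_solution_def by (simp add: \<delta>_def)
  \<comment> \<open>The initial data are prescribed on the open interval only; agreement at time 0
    follows by continuity from the left.\<close>
  have zero: "\<delta> 0 = 0"
  proof -
    have "isCont \<delta> 0" using c\<delta> by (simp add: continuous_on_eq_continuous_at)
    then have "(\<delta> \<longlongrightarrow> \<delta> 0) (at_left 0)" unfolding isCont_def by (auto intro: tendsto_mono[OF at_le])
    moreover have "(\<delta> \<longlongrightarrow> 0) (at_left 0)"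
    proof (rule tendsto_eventually)
      show "\<forall>\<^sub>F s in at_left 0. \<delta> s = 0"
        by (rule eventually_at_leftI[of "-1"]) (auto intro: neg)
    qed
    ultimately show ?thesis using tendsto_unique[OF trivial_limit_at_left_real] by blast
  qed
  have "\<forall>t. -1 < t \<and> t \<le> real n \<longrightarrow> \<delta> t = 0" for n
  proof (induction n)
    case 0
    then show ?case using neg zero by (metis of_nat_0 order_le_less)
  next
    case (Suc n)
    show ?case
    proof (intro allI impI)
      fix t assume t: "-1 < t \<and> t \<le> real (Suc n)"
      show "\<delta> t = 0"
      proof (cases "t \<le> real n")
        case False
        then show ?thesis using Suc t by (intro close[of t "real n"]) auto
      qed (use Suc t in blast)
    qed
  qed
  moreover obtain n where "t \<le> real n" using real_arch_simple by blast
  ultimately show ?thesis using t by (simp add: \<delta>_def)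
qed

subsection \<open>Attractivity\<close>

text \<open>Applied to \<open>\<Phi>\<close> it gives nonnegativity; applied to
  \<open>\<gamma> * \<Phi> + s * \<Gamma>\<close> with \<open>s\<close> equal to 1 and -1 it bounds
  \<open>\<Gamma>\<close> by \<open>\<gamma> * \<Phi>\<close>.\<close>

lemma ge_of_sign_change_derivative:
  fixes P p :: "real \<Rightarrow> real"
  assumes P: "\<And>x. (P has_real_derivative p x) (at x)"
    and "\<And>x. x \<ge> d \<Longrightarrow> p x \<ge> 0" "\<And>x. x \<le> d \<Longrightarrow> p x \<le> 0"
  shows "P d \<le> P x"
proof (cases "d \<le> x")
  case True
  then show ?thesis
    using DERIV_nonneg_imp_nondecreasing[of d x P] assms by blast
next
  case False
  then show ?thesis
    using DERIV_nonpos_imp_nonincreasing[of x d P] assms by force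
qed

lemma neutral_solution_tendsto:
  fixes f g :: "real \<Rightarrow> real"
  assumes c: "c\<^sup>2 = 1" and f: "strict_mono f" "continuous_on UNIV f" and g: "continuous_on UNIV g"
    and \<gamma>: "0 \<le> \<gamma>" "\<gamma> < 1" and gf: "\<And>x. \<bar>g x - g d\<bar> \<le> \<gamma> * \<bar>f x - f d\<bar>"
    and d: "f d + g d = D" and y: "neutral_solution c f g D y0 y"
  shows "(y \<longlongrightarrow> d) at_top"
proof -
  obtain v N where v: "primitive_on y v {-1<..}" "locally_L2_on v {-1<..}" "negligible N"
      "\<And>t. t > 0 \<Longrightarrow> t \<notin> N \<Longrightarrow> v t + c * v (t - 1) + f (y t) + g (y (t - 1)) = D"
    using y unfolding neutral_solution_iff by metis
  have cy: "continuous_on {-1<..} y" by (rule primitive_on_continuous[OF v(1)]) simp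
  define F where "F = (\<lambda>x. f x - f d)"
  define G where "G = (\<lambda>x. g x - g d)"
  have cF: "continuous_on UNIV F" and cG: "continuous_on UNIV G"
    unfolding F_def G_def by (intro continuous_intros f g)+
  have GF: "\<bar>G x\<bar> \<le> \<gamma> * \<bar>F x\<bar>" for x using gf by (simp add: F_def G_def)
  have F_pos: "F x \<ge> 0" if "x \<ge> d" for x
    using that strict_mono_mono[OF f(1)] by (auto simp: F_def mono_def)
  have F_neg: "F x \<le> 0" if "x \<le> d" for x
    using that strict_mono_mono[OF f(1)] by (auto simp: F_def mono_def)
  obtain \<Phi>0 where \<Phi>0: "\<And>x. (\<Phi>0 has_real_derivative F x) (at x)" using antiderivative_exists[OF cF] by blast
  obtain \<Gamma>0 where \<Gamma>0: "\<And>x. (\<Gamma>0 has_real_derivative G x) (at x)" using antiderivative_exists[OF cG] by blast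
  define \<Phi> where "\<Phi> = (\<lambda>x. \<Phi>0 x - \<Phi>0 d)"
  define \<Gamma> where "\<Gamma> = (\<lambda>x. \<Gamma>0 x - \<Gamma>0 d)"
  have \<Phi>: "(\<Phi> has_real_derivative F x) (at x)" and \<Gamma>: "(\<Gamma> has_real_derivative G x) (at x)" for x
    unfolding \<Phi>_def \<Gamma>_def by (auto intro!: derivative_eq_intros \<Phi>0 \<Gamma>0)
  have \<Gamma>\<Phi>: "\<bar>\<Gamma> x\<bar> \<le> \<gamma> * \<Phi> x" for x
  proof -
    have "\<gamma> * \<Phi> d + s * \<Gamma> d \<le> \<gamma> * \<Phi> x + s * \<Gamma> x" if s: "\<bar>s\<bar> = 1" for s
    proof (rule ge_of_sign_change_derivative[of "\<lambda>x. \<gamma> * \<Phi> x + s * \<Gamma> x" "\<lambda>x. \<gamma> * F x + s * G x"])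
      show "((\<lambda>x. \<gamma> * \<Phi> x + s * \<Gamma> x) has_real_derivative \<gamma> * F x + s * G x) (at x)" for x
        by (auto intro!: derivative_eq_intros \<Phi> \<Gamma>)
      have sG: "\<bar>s * G x\<bar> \<le> \<gamma> * \<bar>F x\<bar>" for x using GF s by (simp add: abs_mult)
      show "0 \<le> \<gamma> * F x + s * G x" if "d \<le> x" for x using sG[of x] F_pos[OF that] by (simp add: abs_le_iff)
      show "\<gamma> * F x + s * G x \<le> 0" if "x \<le> d" for x using sG[of x] F_neg[OF that] by (simp add: abs_le_iff)
    qed
    from this[of 1] this[of "-1"] show ?thesis by (simp add: \<Phi>_def \<Gamma>_def abs_le_iff)
  qed
  have \<Phi>_nonneg: "0 \<le> \<Phi> x" for x
    using ge_of_sign_change_derivative[OF \<Phi>, of d x] F_pos F_neg by (simp add: \<Phi>_def)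
  have cFy: "continuous_on {-1<..} (\<lambda>t. F (y t))" and cGy: "continuous_on {-1<..} (\<lambda>t. G (y t))"
    by (auto intro: continuous_on_compose2[OF cF cy] continuous_on_compose2[OF cG cy])
  have "isCont \<Phi> x" for x using \<Phi> DERIV_isCont by blast
  then have "continuous_on UNIV \<Phi>" by (simp add: continuous_at_imp_continuous_on)
  then have c\<Phi>y: "continuous_on {-1<..} (\<lambda>t. \<Phi> (y t))"
    by (rule continuous_on_compose2[OF _ cy]) simp
  define Iv where "Iv = (\<lambda>p q. integral {p..q} (\<lambda>t. (v t)\<^sup>2))"
  define IF where "IF = (\<lambda>p q. integral {p..q} (\<lambda>t. (F (y t))\<^sup>2))"
  define IG where "IG = (\<lambda>p q. integral {p..q} (\<lambda>t. (G (y t))\<^sup>2))"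
  have int: "(\<lambda>t. (v t)\<^sup>2) integrable_on {p..q}" "(\<lambda>t. (F (y t))\<^sup>2) integrable_on {p..q}"
      "(\<lambda>t. (G (y t))\<^sup>2) integrable_on {p..q}" if "-1 < p" for p q
  proof -
    have sub: "{p..q} \<subseteq> {-1<..}" using that by auto
    show "(\<lambda>t. (v t)\<^sup>2) integrable_on {p..q}"
      using v(2) sub abs_integrable_imp_integrable unfolding locally_L2_on_def by blast
    show "(\<lambda>t. (F (y t))\<^sup>2) integrable_on {p..q}" "(\<lambda>t. (G (y t))\<^sup>2) integrable_on {p..q}"
      using continuous_on_subset[OF cFy sub] continuous_on_subset[OF cGy sub]
      by (auto intro!: integrable_continuous_real continuous_on_power)
  qed
  have split: "Iv p r = Iv p q + Iv q r" "IF p r = IF p q + IF q r" if "-1 < p" "p \<le> q" "q \<le> r" for p q r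
    unfolding Iv_def IF_def using int[OF that(1)] that(2,3) by (auto intro!: integral_split_Icc)
  have nonneg: "0 \<le> Iv p q" "0 \<le> IF p q" if "-1 < p" for p q
    unfolding Iv_def IF_def using int[OF that] by (auto intro!: integral_nonneg)
  have IGF: "IG p q \<le> \<gamma>\<^sup>2 * IF p q" if "-1 < p" for p q
  proof -
    have "IG p q \<le> integral {p..q} (\<lambda>t. \<gamma>\<^sup>2 * (F (y t))\<^sup>2)" unfolding IG_def
    proof (rule integral_le)
      show "(G (y t))\<^sup>2 \<le> \<gamma>\<^sup>2 * (F (y t))\<^sup>2" for t
        using power_mono[OF GF[of "y t"], of 2] by (simp add: power_mult_distrib)
    qed (auto intro!: int that integrable_on_mult_right)
    then show ?thesis by (simp add: IF_def)
  qed
  \<comment> \<open>Used with \<open>e = 1\<close>, \<open>H = F\<close> for the present terms and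
    with \<open>e = c\<close>, \<open>H = G\<close> for the delayed ones. The cross term is a
    multiple of the derivative of \<open>\<Psi> (y t)\<close>, hence contributes boundary values
    only.\<close>
  have square: "integral {p..q} (\<lambda>t. (e * v t + H (y t))\<^sup>2)
      = e\<^sup>2 * Iv p q + 2 * e * (\<Psi> (y q) - \<Psi> (y p)) + integral {p..q} (\<lambda>t. (H (y t))\<^sup>2)"
    if pq: "-1 < p" "p \<le> q" and H: "continuous_on UNIV H" "\<And>x. (\<Psi> has_real_derivative H x) (at x)"
    for e p q H \<Psi>
  proof -
    have sub: "{p..q} \<subseteq> {-1<..}" using pq by auto
    note ch = primitive_onD[OF chain_rule_primitive[OF H(2,1) v(1)] pq(2) sub]
    have iH: "(\<lambda>t. (H (y t))\<^sup>2) integrable_on {p..q}"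
      by (intro integrable_continuous_real continuous_on_power continuous_on_compose2[OF H(1)]
          continuous_on_subset[OF cy sub]) auto
    have "((\<lambda>t. e\<^sup>2 * (v t)\<^sup>2 + 2 * e * (H (y t) * v t) + (H (y t))\<^sup>2) has_integral
        e\<^sup>2 * Iv p q + 2 * e * (\<Psi> (y q) - \<Psi> (y p)) + integral {p..q} (\<lambda>t. (H (y t))\<^sup>2)) {p..q}"
      unfolding ch(3) Iv_def
      by (intro has_integral_add has_integral_mult_right integrable_integral int(1)[OF pq(1)] ch(2) iH)
    moreover have "(\<lambda>t. e\<^sup>2 * (v t)\<^sup>2 + 2 * e * (H (y t) * v t) + (H (y t))\<^sup>2) = (\<lambda>t. (e * v t + H (y t))\<^sup>2)"
      by (simp add: fun_eq_iff power2_sum power_mult_distrib algebra_simps)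
    ultimately show ?thesis by (simp add: integral_unique)
  qed
  \<comment> \<open>Positive, so that the equation holds from \<open>a\<close> on and the delayed
    window starts at \<open>a - 1 > -1\<close>, where \<open>v\<close> is known to be square
    integrable.\<close>
  define a :: real where "a = 1 / 2"
  \<comment> \<open>These are the terms left at the initial end after telescoping. The last one
    arises because the delayed integral of \<open>(G (y t))\<^sup>2\<close> starts at
    \<open>a - 1\<close>, whereas that of \<open>(F (y t))\<^sup>2\<close> starts at
    \<open>a\<close>.\<close>
  define C where "C = Iv (a - 1) a + 2 * \<Phi> (y a) - 2 * c * \<Gamma> (y (a - 1)) + \<gamma>\<^sup>2 * IF (a - 1) a"
  have energy: "Iv (T - 1) T + 2 * \<Phi> (y T) + (1 - \<gamma>\<^sup>2) * IF a T \<le> C + 2 * \<gamma> * \<Phi> (y (T - 1))"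
    if T: "a \<le> T" for T
  proof -
    have "integral {a..T} (\<lambda>t. (1 * v t + F (y t))\<^sup>2) = integral {a..T} (\<lambda>t. (c * v (t - 1) + G (y (t - 1)))\<^sup>2)"
    proof (rule integral_spike[OF v(3)])
      fix t assume "t \<in> {a..T} - N"
      then have "c * v (t - 1) + G (y (t - 1)) = - (1 * v t + F (y t))"
        using v(4)[of t] d by (simp add: a_def F_def G_def algebra_simps)
      then show "(c * v (t - 1) + G (y (t - 1)))\<^sup>2 = (1 * v t + F (y t))\<^sup>2" by (simp only: power2_minus)
    qed
    also have "\<dots> = integral {a - 1..T - 1} (\<lambda>t. (c * v t + G (y t))\<^sup>2)"
      using integral_shift_one[of a T "\<lambda>t. (c * v t + G (y t))\<^sup>2"] .
    finally have "Iv a T + 2 * (\<Phi> (y T) - \<Phi> (y a)) + IF a T =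
        Iv (a - 1) (T - 1) + 2 * c * (\<Gamma> (y (T - 1)) - \<Gamma> (y (a - 1))) + IG (a - 1) (T - 1)"
      using square[of a T F \<Phi> 1] square[of "a - 1" "T - 1" G \<Gamma> c] T c \<Phi> \<Gamma> cF cG
      by (simp add: a_def IF_def IG_def)
    moreover have "Iv (a - 1) T = Iv (a - 1) a + Iv a T" "Iv (a - 1) T = Iv (a - 1) (T - 1) + Iv (T - 1) T"
      "IF (a - 1) T = IF (a - 1) a + IF a T" "IF (a - 1) T = IF (a - 1) (T - 1) + IF (T - 1) T"
      using T by (auto intro!: split simp: a_def)
    moreover have "IG (a - 1) (T - 1) \<le> \<gamma>\<^sup>2 * IF (a - 1) T"
    proof -
      have "IF (a - 1) (T - 1) \<le> IF (a - 1) T"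
        using nonneg(2)[of "T - 1" T] T split(2)[of "a - 1" "T - 1" T] by (simp add: a_def)
      then have "\<gamma>\<^sup>2 * IF (a - 1) (T - 1) \<le> \<gamma>\<^sup>2 * IF (a - 1) T" by (intro mult_left_mono) auto
      then show ?thesis using IGF[of "a - 1" "T - 1"] by (simp add: a_def)
    qed
    moreover have "2 * c * \<Gamma> (y (T - 1)) \<le> 2 * \<gamma> * \<Phi> (y (T - 1))"
    proof -
      have "\<bar>c\<bar> = 1" using c by (metis abs_1 power2_eq_1_iff abs_minus_cancel)
      then have "\<bar>c * \<Gamma> (y (T - 1))\<bar> \<le> \<gamma> * \<Phi> (y (T - 1))" using \<Gamma>\<Phi> by (simp add: abs_mult)
      then show ?thesis by (simp add: abs_le_iff)
    qed
    ultimately show ?thesis unfolding C_def by (simp add: algebra_simps)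
  qed
  have \<gamma>2: "0 < 1 - \<gamma>\<^sup>2" using \<gamma> by (simp add: power_less_one_iff abs_square_less_1)
  have \<Phi>_rec: "\<Phi> (y T) \<le> C / 2 + \<gamma> * \<Phi> (y (T - 1))" if "a \<le> T" for T
  proof -
    have "0 \<le> (1 - \<gamma>\<^sup>2) * IF a T" using nonneg(2)[of a T] \<gamma>2 by (simp add: a_def)
    then show ?thesis using energy[OF that] nonneg(1)[of "T - 1" T] that by (simp add: a_def)
  qed
  obtain B1 where B1: "\<And>t. t \<in> {a - 1..a} \<Longrightarrow> \<Phi> (y t) \<le> B1"
  proof -
    have "continuous_on {a - 1..a} (\<lambda>t. \<Phi> (y t))"
      by (rule continuous_on_subset[OF c\<Phi>y]) (auto simp: a_def)
    then have "compact ((\<lambda>t. \<Phi> (y t)) ` {a - 1..a})" by (intro compact_continuous_image) auto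
    then show thesis using that by (metis compact_imp_bounded bounded_iff imageI real_norm_def abs_le_D1)
  qed
  \<comment> \<open>\<open>C / (2 * (1 - \<gamma>))\<close> is the fixed point of the recursion
    \<open>\<Phi>_rec\<close>. A bound not below it reproduces itself, and \<open>B1\<close> takes
    care of the initial window.\<close>
  define B where "B = max B1 (C / (2 * (1 - \<gamma>)))"
  have "C / 2 \<le> (1 - \<gamma>) * B"
  proof -
    have "C / 2 = (1 - \<gamma>) * (C / (2 * (1 - \<gamma>)))" using \<gamma>(2) by (simp add: field_simps)
    also have "\<dots> \<le> (1 - \<gamma>) * B" using \<gamma>(2) by (intro mult_left_mono) (auto simp: B_def)
    finally show ?thesis .
  qed
  then have CB: "C / 2 + \<gamma> * B \<le> B" by (simp add: algebra_simps)
  have "\<forall>t. a - 1 \<le> t \<and> t \<le> a + real n \<longrightarrow> \<Phi> (y t) \<le> B" for n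
  proof (induction n)
    case 0
    then show ?case using B1 by (auto simp: B_def max_def intro: order_trans)
  next
    case (Suc n)
    show ?case
    proof (intro allI impI)
      fix t assume t: "a - 1 \<le> t \<and> t \<le> a + real (Suc n)"
      show "\<Phi> (y t) \<le> B"
      proof (cases "t \<le> a")
        case False
        then have "\<Phi> (y (t - 1)) \<le> B" using Suc t by auto
        then have "\<gamma> * \<Phi> (y (t - 1)) \<le> \<gamma> * B" using \<gamma>(1) by (rule mult_left_mono)
        then show ?thesis using \<Phi>_rec[of t] CB False by linarith
      qed (use Suc t in auto)
    qed
  qed
  then have \<Phi>_bound: "\<Phi> (y t) \<le> B" if "a - 1 \<le> t" for t
    using that by (metis add.commute diff_le_eq real_arch_simple)
  define K where "K = C + 2 * \<gamma> * B"
  have en: "Iv (T - 1) T + (1 - \<gamma>\<^sup>2) * IF a T \<le> K" if "a \<le> T" for T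
  proof -
    have "2 * \<gamma> * \<Phi> (y (T - 1)) \<le> 2 * \<gamma> * B" using \<Phi>_bound[of "T - 1"] that \<gamma>(1) by (intro mult_left_mono) auto
    then show ?thesis using energy[OF that] \<Phi>_nonneg[of "y T"] unfolding K_def by linarith
  qed
  have Iv_bound: "Iv (T - 1) T \<le> K" if "a \<le> T" for T
  proof -
    have "0 \<le> (1 - \<gamma>\<^sup>2) * IF a T" using nonneg(2)[of a T] \<gamma>2 by (simp add: a_def)
    then show ?thesis using en[OF that] by linarith
  qed
  have IF_bound: "IF a T \<le> K / (1 - \<gamma>\<^sup>2)" if "a \<le> T" for T
    using en[OF that] nonneg(1)[of "T - 1" T] that \<gamma>2 by (simp add: a_def field_simps)
  have K0: "0 \<le> K" using Iv_bound[of a] nonneg(1)[of "a - 1" a] by (simp add: a_def)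
  show ?thesis
  proof (rule tendstoI)
    fix e :: real assume e: "e > 0"
    \<comment> \<open>Chosen for the two halves of the oscillation estimate in \<open>osc\<close>:
      \<open>\<eta> * K\<close> and \<open>\<delta> / (4 * \<eta>)\<close> must each be at most
      \<open>e / 4\<close>. The summand 1 in \<open>K + 1\<close> guards against
      \<open>K = 0\<close>, and \<open>\<delta> \<le> 1\<close> keeps
      \<open>{T - \<delta>..T}\<close> inside one unit window.\<close>
    define \<eta> where "\<eta> = e / (4 * (K + 1))"
    define \<delta> where "\<delta> = min 1 (\<eta> * e)"
    define m where "m = min ((F (d + e / 2))\<^sup>2) ((F (d - e / 2))\<^sup>2)"
    have \<eta>: "0 < \<eta>" "\<eta> * K \<le> e / 4" using e K0 by (auto simp: \<eta>_def field_simps)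
    have \<delta>: "0 < \<delta>" "\<delta> \<le> 1" "\<delta> / (4 * \<eta>) \<le> e / 4" using e \<eta>(1) by (auto simp: \<delta>_def field_simps min_def)
    have m: "0 < m"
      using e strict_monoD[OF f(1), of d "d + e / 2"] strict_monoD[OF f(1), of "d - e / 2" d]
      by (simp add: m_def F_def)
    have m_le: "m \<le> (F x)\<^sup>2" if "e / 2 \<le> \<bar>x - d\<bar>" for x
    proof (cases "x \<ge> d")
      case True
      then have "F (d + e / 2) \<le> F x" "0 \<le> F (d + e / 2)"
        using that e strict_mono_mono[OF f(1)] F_pos by (auto simp: F_def mono_def)
      then have "(F (d + e / 2))\<^sup>2 \<le> (F x)\<^sup>2" by (rule power_mono)
      then show ?thesis by (simp add: m_def)
    next
      case False
      then have "- F (d - e / 2) \<le> - F x" "0 \<le> - F (d - e / 2)"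
        using that e strict_mono_mono[OF f(1)] F_neg by (auto simp: F_def mono_def)
      then have "(- F (d - e / 2))\<^sup>2 \<le> (- F x)\<^sup>2" by (rule power_mono)
      then show ?thesis by (simp add: m_def)
    qed
    \<comment> \<open>Young's inequality
      \<open>\<bar>v\<bar> \<le> \<eta> * v\<^sup>2 + 1 / (4 * \<eta>)\<close> is integrated over
      \<open>{t..T}\<close>. Only the energy of the window \<open>{T - 1..T}\<close> enters, so the
      modulus of continuity does not depend on \<open>T\<close>.\<close>
    have osc: "\<bar>y T - y t\<bar> \<le> e / 2" if T: "a \<le> T" and t: "T - \<delta> \<le> t" "t \<le> T" for t T
    proof -
      have sub: "{t..T} \<subseteq> {-1<..}" "-1 < t" "-1 < T - 1" "T - 1 \<le> t" using T t \<delta> by (auto simp: a_def)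
      note yt = primitive_onD[OF v(1) t(2) sub(1)]
      have "\<bar>y T - y t\<bar> \<le> integral {t..T} (\<lambda>t. \<eta> * (v t)\<^sup>2 + 1 / (4 * \<eta>))"
        unfolding yt(3) real_norm_def[symmetric]
      proof (rule integral_norm_bound_integral[OF yt(2)])
        show "(\<lambda>t. \<eta> * (v t)\<^sup>2 + 1 / (4 * \<eta>)) integrable_on {t..T}"
          by (intro integrable_add integrable_on_mult_right int sub integrable_const_ivl)
        fix r
        have "4 * \<eta> * \<bar>v r\<bar> \<le> (2 * \<eta> * \<bar>v r\<bar>)\<^sup>2 + 1"
          using sum_squares_bound[of "2 * \<eta> * \<bar>v r\<bar>" 1] by simp
        then show "norm (v r) \<le> \<eta> * (v r)\<^sup>2 + 1 / (4 * \<eta>)"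
          using \<eta>(1) by (simp add: field_simps power2_eq_square)
      qed
      also have "\<dots> = \<eta> * Iv t T + (T - t) / (4 * \<eta>)"
        unfolding Iv_def using int(1)[OF sub(2)] t
        by (subst integral_add) (auto intro: integrable_on_mult_right)
      also have "\<eta> * Iv t T \<le> \<eta> * Iv (T - 1) T"
        using split(1)[OF sub(3,4) t(2)] nonneg(1)[OF sub(3), of t] \<eta>(1) by simp
      also have "\<eta> * Iv (T - 1) T \<le> \<eta> * K" using Iv_bound[OF T] \<eta>(1) by simp
      also have "\<eta> * K \<le> e / 4" by (rule \<eta>(2))
      also have "(T - t) / (4 * \<eta>) \<le> \<delta> / (4 * \<eta>)" using t \<eta>(1) by (intro divide_right_mono) auto
      also have "\<delta> / (4 * \<eta>) \<le> e / 4" by (rule \<delta>(3))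
      finally show ?thesis by simp
    qed
    \<comment> \<open>\<open>IF a\<close> is nondecreasing and bounded, so after some
      \<open>T0\<close> less than \<open>m * \<delta>\<close> of it is left. A deviation of size
      \<open>e\<close> at time \<open>T\<close> would persist at size \<open>e / 2\<close> on
      \<open>{T - \<delta>..T}\<close> and use up at least \<open>m * \<delta>\<close>.\<close>
    define S where "S = (SUP T\<in>{a..}. IF a T)"
    have bdd: "bdd_above (IF a ` {a..})" using IF_bound by (auto simp: bdd_above_def)
    have "\<exists>x\<in>IF a ` {a..}. S - m * \<delta> < x"
      using less_cSup_iff[of "IF a ` {a..}" "S - m * \<delta>"] bdd m \<delta>(1) by (simp add: S_def)
    then obtain T0 where T0: "a \<le> T0" "S - m * \<delta> < IF a T0" by auto
    show "\<forall>\<^sub>F t in at_top. dist (y t) d < e"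
    proof (rule eventually_at_top_linorderI)
      fix T assume T: "T0 + 1 \<le> T"
      have order: "a \<le> T0" "T0 \<le> T - \<delta>" "T - \<delta> \<le> T" "a \<le> T" using T T0 \<delta> by auto
      have a': "-1 < a" by (simp add: a_def)
      have "IF a T = IF a T0 + IF T0 (T - \<delta>) + IF (T - \<delta>) T"
        using split(2)[of a T0 T] split(2)[of T0 "T - \<delta>" T] order a' by simp
      moreover have "IF a T \<le> S" unfolding S_def using bdd order(4) by (intro cSUP_upper) auto
      moreover have "0 \<le> IF T0 (T - \<delta>)" using nonneg(2) order a' by simp
      ultimately have small: "IF (T - \<delta>) T < m * \<delta>" using T0(2) by linarith
      show "dist (y T) d < e"
      proof (rule ccontr)
        assume "\<not> dist (y T) d < e"
        then have far: "e \<le> \<bar>y T - d\<bar>" by (simp add: dist_real_def)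
        have "m * \<delta> = integral {T - \<delta>..T} (\<lambda>_. m)" using \<delta>(1) by simp
        also have "\<dots> \<le> IF (T - \<delta>) T" unfolding IF_def
        proof (rule integral_le)
          show "(\<lambda>t. (F (y t))\<^sup>2) integrable_on {T - \<delta>..T}" using order a' by (intro int) auto
          fix t assume t: "t \<in> {T - \<delta>..T}"
          have "\<bar>y T - y t\<bar> \<le> e / 2" using osc[OF order(4)] t by auto
          then show "m \<le> (F (y t))\<^sup>2" using far by (intro m_le) linarith
        qed (rule integrable_const_ivl)
        finally show False using small by simp
      qed
    qed
  qed
qed

subsection \<open>Existence\<close>

text \<open>Above the level \<open>m\<close> the function cannot increase. The argument runs through
  the squared positive part of \<open>w - m\<close>, which is continuously differentiable and thus
  within reach of the chain rule, and which starts at 0.\<close>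

lemma barrier_primitive:
  assumes w: "primitive_on w x {a..b}" and wa: "w a \<le> m"
    and neg: "\<And>r. r \<in> {a..b} \<Longrightarrow> m < w r \<Longrightarrow> x r \<le> 0" and t: "t \<in> {a..b}"
  shows "w t \<le> m"
proof -
  define Q where "Q = (\<lambda>z::real. (max 0 (z - m))\<^sup>2)"
  have Q: "(Q has_real_derivative 2 * max 0 (z - m)) (at z)" for z
  proof (cases z m rule: linorder_cases)
    case less
    have "(Q has_real_derivative 0) (at z)"
      by (rule has_field_derivative_transform_within_open[OF DERIV_const, of "{..<m}" _ 0])
        (use less in \<open>auto simp: Q_def\<close>)
    then show ?thesis using less by simp
  next
    case equal
    have "(Q has_real_derivative 0) (at z)"
      by (rule DERIV_zero_of_quadratic_bound[where C = 1])
        (auto simp: Q_def equal max_def power2_eq_square)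
    then show ?thesis using equal by simp
  next
    case greater
    have "((\<lambda>z. (z - m)\<^sup>2) has_real_derivative 2 * (z - m)) (at z)"
      by (auto intro!: derivative_eq_intros)
    then have "(Q has_real_derivative 2 * (z - m)) (at z)"
      by (rule has_field_derivative_transform_within_open[of _ _ _ "{m<..}"])
        (use greater in \<open>auto simp: Q_def\<close>)
    then show ?thesis using greater by simp
  qed
  have "primitive_on (\<lambda>t. Q (w t)) (\<lambda>t. 2 * max 0 (w t - m) * x t) {a..b}"
    by (rule chain_rule_primitive[OF Q _ w]) (intro continuous_intros)
  then have p: "primitive_on (\<lambda>t. Q (w t)) (\<lambda>t. 2 * max 0 (w t - m) * x t) {a..t}"
    by (rule primitive_on_subset) (use t in auto)
  have at: "a \<le> t" using t by simp
  have "Q (w t) - Q (w a) = integral {a..t} (\<lambda>t. 2 * max 0 (w t - m) * x t)"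
    by (rule primitive_onD(3)[OF p at subset_refl])
  also have "\<dots> \<le> integral {a..t} (\<lambda>_. 0)"
  proof (rule integral_le[OF primitive_onD(2)[OF p at subset_refl] integrable_0])
    fix r assume r: "r \<in> {a..t}"
    show "2 * max 0 (w r - m) * x r \<le> 0"
    proof (cases "m < w r")
      case True
      then have "x r \<le> 0" using r t by (intro neg) auto
      then show ?thesis using True by (simp add: mult_nonneg_nonpos)
    qed simp
  qed
  finally have "Q (w t) \<le> 0" using wa by (simp add: Q_def)
  then show ?thesis by (simp add: Q_def)
qed

section \<open>Integral equations with Lipschitz and with monotone nonlinearity\<close>

lemma exp_weight_integral:
  fixes L :: real
  assumes "a \<le> t"
  shows "((\<lambda>s. L * exp (2 * L * (s - a))) has_integral (exp (2 * L * (t - a)) - 1) / 2) {a..t}"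
proof -
  have "((\<lambda>s. L * exp (2 * L * (s - a))) has_integral exp (2 * L * (t - a)) / 2 - exp (2 * L * (a - a)) / 2) {a..t}"
    by (rule fundamental_theorem_of_calculus[OF assms])
      (auto intro!: derivative_eq_intros simp flip: has_real_derivative_iff_has_vector_derivative)
  then show ?thesis by (simp add: diff_divide_distrib)
qed

text \<open>The weight \<open>exp (2 L (t - a))\<close> makes the Picard map a contraction on the whole interval.\<close>

lemma lipschitz_integral_equation:
  fixes F P :: "real \<Rightarrow> real"
  assumes ab: "a \<le> b" and P: "continuous_on {a..b} P"
    and F: "\<And>x y. \<bar>F x - F y\<bar> \<le> L * \<bar>x - y\<bar>"
  obtains y where "continuous_on {a..b} y" "\<And>t. t \<in> {a..b} \<Longrightarrow> y t = P t - integral {a..t} (\<lambda>s. F (y s))"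
proof -
  have L: "0 \<le> L" using F[of 1 0] by (simp add: order_trans[OF abs_ge_zero])
  have "isCont F x" for x
  proof -
    have "(\<lambda>y. F y - F x) \<midarrow>x\<rightarrow> 0"
    proof (rule Lim_null_comparison)
      show "\<forall>\<^sub>F y in at x. norm (F y - F x) \<le> L * \<bar>y - x\<bar>" using F by simp
      have "((\<lambda>y. L * \<bar>y - x\<bar>) \<longlongrightarrow> L * \<bar>x - x\<bar>) (at x)" by (intro tendsto_intros)
      then show "((\<lambda>y. L * \<bar>y - x\<bar>) \<longlongrightarrow> 0) (at x)" by simp
    qed
    then show ?thesis unfolding isCont_def by (simp add: LIM_zero_iff)
  qed
  then have cF: "continuous_on UNIV F" by (simp add: continuous_at_imp_continuous_on)
  \<comment> \<open>Clamping time to \<open>{a..b}\<close> turns continuous functions on the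
    interval into bounded continuous functions on the line, a complete space for the fixed point
    theorem.\<close>
  define \<tau> where "\<tau> = (\<lambda>t. max a (min b t))"
  define E where "E = (\<lambda>s. exp (2 * L * (s - a)))"
  \<comment> \<open>The Picard map for the rescaled unknown \<open>u = y / E\<close>: the plain sup
    norm of \<open>u\<close> is the weighted norm of \<open>y\<close>.\<close>
  define N where "N = (\<lambda>(u::real \<Rightarrow>\<^sub>C real) t. (P t - integral {a..t} (\<lambda>s. F (E s * u s))) / E t)"
  have \<tau>: "\<tau> t \<in> {a..b}" for t using ab by (auto simp: \<tau>_def)
  have c\<tau>: "continuous_on UNIV \<tau>" unfolding \<tau>_def by (intro continuous_intros)
  have cFu: "continuous_on S (\<lambda>s. F (E s * u s))" for S and u :: "real \<Rightarrow>\<^sub>C real"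
    by (rule continuous_on_compose2[OF cF]) (auto simp: E_def intro!: continuous_intros)
  have iFu: "(\<lambda>s. F (E s * u s)) integrable_on {p..q}" for p q and u :: "real \<Rightarrow>\<^sub>C real"
    by (intro integrable_continuous_real cFu)
  have cN: "continuous_on {a..b} (N u)" for u
    unfolding N_def
    by (intro continuous_intros P indefinite_integral_continuous_1 iFu) (auto simp: E_def intro!: continuous_intros)
  have NB: "(\<lambda>t. N u (\<tau> t)) \<in> bcontfun" for u
  proof -
    have "continuous_on UNIV (\<lambda>t. N u (\<tau> t))"
      by (rule continuous_on_compose2[OF cN c\<tau>]) (use \<tau> in auto)
    moreover have "bounded (N u ` {a..b})"
      by (intro compact_imp_bounded compact_continuous_image cN) simp
    then have "bounded (range (\<lambda>t. N u (\<tau> t)))"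
      by (rule bounded_subset) (use \<tau> in auto)
    ultimately show ?thesis by (simp add: bcontfun_def)
  qed
  define T where "T = (\<lambda>u. Bcontfun (\<lambda>t. N u (\<tau> t)))"
  have T: "apply_bcontfun (T u) t = N u (\<tau> t)" for u t
    unfolding T_def by (simp add: Bcontfun_inverse[OF NB])
  have lip: "dist (T u) (T u') \<le> 1 / 2 * dist u u'" for u u'
  proof (rule dist_bound)
    fix t
    let ?t = "\<tau> t"
    have at: "a \<le> ?t" using \<tau>[of t] by simp
    have "\<bar>integral {a..?t} (\<lambda>s. F (E s * u s)) - integral {a..?t} (\<lambda>s. F (E s * u' s))\<bar>
        = norm (integral {a..?t} (\<lambda>s. F (E s * u s) - F (E s * u' s)))"
      using iFu by (simp add: integral_diff)
    also have "\<dots> \<le> integral {a..?t} (\<lambda>s. dist u u' * (L * E s))"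
    proof (rule integral_norm_bound_integral)
      show "(\<lambda>s. F (E s * u s) - F (E s * u' s)) integrable_on {a..?t}"
        by (intro integrable_diff iFu)
      show "(\<lambda>s. dist u u' * (L * E s)) integrable_on {a..?t}"
        unfolding E_def by (intro integrable_continuous_real continuous_intros)
      fix s
      have "\<bar>F (E s * u s) - F (E s * u' s)\<bar> \<le> L * \<bar>E s * u s - E s * u' s\<bar>" by (rule F)
      also have "\<bar>E s * u s - E s * u' s\<bar> = E s * dist (u s) (u' s)"
        by (simp add: dist_real_def E_def abs_mult right_diff_distrib[symmetric])
      also have "L * \<dots> \<le> L * (E s * dist u u')"
        using L dist_bounded[of u s u'] by (intro mult_left_mono) (auto simp: E_def)
      finally show "norm (F (E s * u s) - F (E s * u' s)) \<le> dist u u' * (L * E s)" by (simp add: mult_ac)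
    qed
    \<comment> \<open>The factor 2 in the exponent of \<open>E\<close> makes the integral of
      \<open>L * E\<close> less than half of \<open>E ?t\<close>; this is the origin of the
      contraction constant 1/2, whatever the length of the interval.\<close>
    also have "\<dots> = dist u u' * ((E ?t - 1) / 2)"
      by (subst integral_mult_right) (simp only: E_def integral_unique[OF exp_weight_integral[OF at]])
    also have "\<dots> \<le> dist u u' * (E ?t / 2)" by (intro mult_left_mono) auto
    finally have "\<bar>integral {a..?t} (\<lambda>s. F (E s * u s)) - integral {a..?t} (\<lambda>s. F (E s * u' s))\<bar> / E ?t
        \<le> 1 / 2 * dist u u'" by (simp add: E_def divide_le_eq)
    then show "dist (apply_bcontfun (T u) t) (apply_bcontfun (T u') t) \<le> 1 / 2 * dist u u'"
      unfolding T N_def dist_real_def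
      by (simp add: diff_divide_distrib[symmetric] abs_divide E_def abs_minus_commute)
  qed
  obtain u where u: "T u = u" using banach_fix_type[of "1 / 2" T] lip by auto
  define y where "y = (\<lambda>t. E t * u t)"
  show thesis
  proof
    show "continuous_on {a..b} y" unfolding y_def E_def by (intro continuous_intros) auto
    fix t assume t: "t \<in> {a..b}"
    then have "\<tau> t = t" by (auto simp: \<tau>_def)
    then have "u t = N u t" using T[of u t] u by simp
    then show "y t = P t - integral {a..t} (\<lambda>s. F (y s))"
      by (simp add: y_def N_def E_def)
  qed
qed

text \<open>On bounded sets \<open>f\<close> is Lipschitz, so the equation is solved with the
  argument of \<open>f\<close> clamped to \<open>{- 2 * m..2 * m}\<close>. If
  \<open>w = y - P\<close> exceeds \<open>m\<close>, then \<open>y\<close> is positive and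
  \<open>- f (\<kappa> (y r))\<close> pulls \<open>w\<close> back; symmetrically below
  \<open>- m\<close>. Hence \<open>\<bar>y\<bar> \<le> 2 * m\<close> and the clamp is
  inactive.\<close>

lemma monotone_integral_equation:
  fixes f P :: "real \<Rightarrow> real"
  assumes ab: "a \<le> b" and P: "continuous_on {a..b} P"
    and f: "mono f" "f 0 = 0" and f': "\<And>x. (f has_real_derivative f' x) (at x)" "continuous_on UNIV f'"
  obtains y where "continuous_on {a..b} y" "\<And>t. t \<in> {a..b} \<Longrightarrow> y t = P t - integral {a..t} (\<lambda>s. f (y s))"
proof -
  have "compact (P ` {a..b})" using P by (intro compact_continuous_image) auto
  then obtain m where m: "\<And>t. t \<in> {a..b} \<Longrightarrow> \<bar>P t\<bar> \<le> m"
    by (metis compact_imp_bounded bounded_iff imageI real_norm_def)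
  have m0: "0 \<le> m" using m[of a] ab by auto
  define \<kappa> where "\<kappa> = (\<lambda>x. max (- 2 * m) (min (2 * m) x))"
  have \<kappa>: "\<kappa> x \<in> {- 2 * m..2 * m}" for x using m0 by (auto simp: \<kappa>_def)
  have "compact (f' ` {- 2 * m..2 * m})"
    using f'(2) by (intro compact_continuous_image) (auto intro: continuous_on_subset)
  then obtain L where L: "\<And>x. x \<in> {- 2 * m..2 * m} \<Longrightarrow> \<bar>f' x\<bar> \<le> L"
    by (metis compact_imp_bounded bounded_iff imageI real_norm_def)
  have L0: "0 \<le> L" using L[of 0] m0 by auto
  have "\<bar>f (\<kappa> x) - f (\<kappa> z)\<bar> \<le> L * \<bar>x - z\<bar>" for x z
  proof -
    have "norm (f (\<kappa> x) - f (\<kappa> z)) \<le> L * norm (\<kappa> x - \<kappa> z)"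
      by (rule field_differentiable_bound[of "{- 2 * m..2 * m}" f f'])
        (use L \<kappa> in \<open>auto intro: has_field_derivative_at_within f'\<close>)
    also have "\<dots> \<le> L * \<bar>x - z\<bar>" using L0 by (intro mult_left_mono) (auto simp: \<kappa>_def max_def min_def)
    finally show ?thesis by simp
  qed
  then obtain y where y: "continuous_on {a..b} y"
      "\<And>t. t \<in> {a..b} \<Longrightarrow> y t = P t - integral {a..t} (\<lambda>s. f (\<kappa> (y s)))"
    using lipschitz_integral_equation[OF ab P, of "\<lambda>x. f (\<kappa> x)" L] by metis
  \<comment> \<open>The barrier is run for \<open>y - P\<close> since \<open>P\<close> is merely
    continuous: \<open>w\<close> is a primitive, whereas \<open>y\<close> need not be one.\<close>
  define w where "w = (\<lambda>t. - integral {a..t} (\<lambda>s. f (\<kappa> (y s))))"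
  have "isCont f x" for x using f'(1) DERIV_isCont by blast
  then have cf: "continuous_on UNIV f" by (simp add: continuous_at_imp_continuous_on)
  have cfy: "continuous_on {a..b} (\<lambda>s. f (\<kappa> (y s)))"
    by (rule continuous_on_compose2[OF cf]) (auto simp: \<kappa>_def intro!: continuous_intros y(1))
  have w: "primitive_on w (\<lambda>t. - f (\<kappa> (y t))) {a..b}"
    unfolding primitive_on_def
  proof (intro allI impI conjI)
    fix s t assume st: "s \<le> t" "{s..t} \<subseteq> {a..b}"
    show "(\<lambda>t. - f (\<kappa> (y t))) absolutely_integrable_on {s..t}"
      by (intro absolutely_integrable_continuous_real continuous_intros continuous_on_subset[OF cfy st(2)])
    have st': "a \<le> s" "t \<le> b" using st by auto
    have "(\<lambda>s. f (\<kappa> (y s))) integrable_on {a..t}"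
      by (intro integrable_continuous_real continuous_on_subset[OF cfy]) (use st' in auto)
    from integral_split_Icc[OF this st'(1) st(1)]
    show "w t - w s = integral {s..t} (\<lambda>t. - f (\<kappa> (y t)))" by (simp add: w_def)
  qed
  have yw: "y t = P t + w t" if "t \<in> {a..b}" for t using y(2)[OF that] by (simp add: w_def)
  have w_le: "w t \<le> m" if "t \<in> {a..b}" for t
  proof (rule barrier_primitive[OF w _ _ that])
    show "w a \<le> m" using m0 by (simp add: w_def)
    fix r assume r: "r \<in> {a..b}" "m < w r"
    then have "0 \<le> \<kappa> (y r)" using m[OF r(1)] yw[OF r(1)] m0 by (auto simp: \<kappa>_def)
    then have "f 0 \<le> f (\<kappa> (y r))" using f(1) by (simp add: mono_def)
    then show "- f (\<kappa> (y r)) \<le> 0" using f(2) by simp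
  qed
  have w': "primitive_on (\<lambda>t. (-1) * w t + 0 * w t) (\<lambda>t. (-1) * (- f (\<kappa> (y t))) + 0 * (- f (\<kappa> (y t)))) {a..b}"
    by (rule primitive_on_lin[OF w w])
  have w_ge: "(-1) * w t + 0 * w t \<le> m" if "t \<in> {a..b}" for t
  proof (rule barrier_primitive[OF w' _ _ that])
    show "(-1) * w a + 0 * w a \<le> m" using m0 by (simp add: w_def)
    fix r assume r: "r \<in> {a..b}" "m < (-1) * w r + 0 * w r"
    then have "\<kappa> (y r) \<le> 0" using m[OF r(1)] yw[OF r(1)] m0 by (auto simp: \<kappa>_def)
    then have "f (\<kappa> (y r)) \<le> f 0" using f(1) by (simp add: mono_def)
    then show "(-1) * (- f (\<kappa> (y r))) + 0 * (- f (\<kappa> (y r))) \<le> 0" using f(2) by simp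
  qed
  have \<kappa>y: "\<kappa> (y t) = y t" if "t \<in> {a..b}" for t
    using yw[OF that] w_le[OF that] w_ge[OF that] m[OF that] by (auto simp: \<kappa>_def)
  show thesis
  proof
    show "continuous_on {a..b} y" by (rule y(1))
    fix t assume t: "t \<in> {a..b}"
    have "integral {a..t} (\<lambda>s. f (\<kappa> (y s))) = integral {a..t} (\<lambda>s. f (y s))"
      by (rule Henstock_Kurzweil_Integration.integral_cong) (use t \<kappa>y in auto)
    then show "y t = P t - integral {a..t} (\<lambda>s. f (y s))" using y(2)[OF t] by simp
  qed
qed

text \<open>With \<open>y t = A + integral {-1..t} v\<close>, every delayed quantity on
  \<open>(n, n + 1]\<close> is already determined by \<open>v\<close> up to time \<open>n\<close>.
  What remains is a scalar integral equation without delay for the new piece of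
  \<open>y\<close>.\<close>

lemma neutral_extension_step:
  fixes f g v :: "real \<Rightarrow> real" and n :: real
  assumes n: "0 \<le> n" and v: "locally_L2_on v {-1..n}"
    and f: "mono f" "f 0 = 0" and f': "\<And>x. (f has_real_derivative f' x) (at x)" "continuous_on UNIV f'"
    and g: "continuous_on UNIV g"
  obtains v' where "locally_L2_on v' {-1..n + 1}" "\<And>t. t \<le> n \<Longrightarrow> v' t = v t"
    "\<And>t. n < t \<Longrightarrow> t \<le> n + 1 \<Longrightarrow>
       v' t + c * v' (t - 1) + f (A + integral {-1..t} v') + g (A + integral {-1..t - 1} v') = D"
proof -
  define Y where "Y = (\<lambda>t. A + integral {-1..t} v)"
  have v_abs: "v absolutely_integrable_on {-1..n}" using v by (simp add: locally_L2_on_Icc)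
  have cY: "continuous_on {-1..n} Y" unfolding Y_def
    by (intro continuous_intros indefinite_integral_continuous_1 abs_integrable_imp_integrable v_abs)
  \<comment> \<open>The known part of the right-hand side: the equation on the new step reads
    \<open>v' t = q t - f (y t)\<close>.\<close>
  define q where "q = (\<lambda>t. 1 * (D - g (Y (t - 1))) + (- c) * v (t - 1))"
  have q: "locally_L2_on q {n..n + 1}" unfolding q_def
  proof (rule locally_L2_on_lin)
    show "locally_L2_on (\<lambda>t. D - g (Y (t - 1))) {n..n + 1}"
      using n by (intro locally_L2_on_continuous continuous_intros
          continuous_on_compose2[OF g] continuous_on_compose2[OF cY]) auto
    have "locally_L2_on v {n - 1..n + 1 - 1}"
      by (rule locally_L2_on_subset[OF v]) (use n in auto)
    then show "locally_L2_on (\<lambda>t. v (t - 1)) {n..n + 1}" by (rule locally_L2_on_shift)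
  qed
  then have qi: "q integrable_on {n..n + 1}"
    by (intro abs_integrable_imp_integrable) (simp add: locally_L2_on_Icc)
  define P where "P = (\<lambda>t. Y n + integral {n..t} q)"
  have cP: "continuous_on {n..n + 1} P" unfolding P_def
    by (intro continuous_intros indefinite_integral_continuous_1 qi)
  obtain w where w: "continuous_on {n..n + 1} w"
      "\<And>t. t \<in> {n..n + 1} \<Longrightarrow> w t = P t - integral {n..t} (\<lambda>s. f (w s))"
    using monotone_integral_equation[OF _ cP f f'] by (metis le_add_same_cancel1 zero_le_one)
  have "isCont f x" for x using f'(1) DERIV_isCont by blast
  then have "continuous_on UNIV f" by (simp add: continuous_at_imp_continuous_on)
  then have cfw: "continuous_on {n..n + 1} (\<lambda>t. f (w t))"
    by (rule continuous_on_compose2[OF _ w(1)]) simp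
  \<comment> \<open>At the joint \<open>t = n\<close> the old value is kept; the mismatch with the
    new formula is confined to one point and disappears under the integral.\<close>
  define v' where "v' = (\<lambda>t. if t \<le> n then v t else 1 * q t + (-1) * f (w t))"
  have v'_le: "v' t = v t" if "t \<le> n" for t using that by (simp add: v'_def)
  have L2: "locally_L2_on v' {-1..n + 1}"
  proof (rule locally_L2_on_combine)
    show "locally_L2_on v' {-1..n}"
      by (rule locally_L2_on_spike[OF v negligible_empty]) (simp add: v'_def)
    show "locally_L2_on v' {n..n + 1}"
      by (rule locally_L2_on_spike[OF locally_L2_on_lin[OF q locally_L2_on_continuous[OF cfw], of 1 "-1"] negligible_sing])
        (auto simp: v'_def)
  qed (use n in auto)
  then have v'i: "v' integrable_on {-1..t}" if "t \<le> n + 1" for t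
    using that unfolding locally_L2_on_def
    by (intro abs_integrable_imp_integrable) (simp add: atLeastatMost_subset_iff)
  have Y'_le: "A + integral {-1..t} v' = Y t" if "t \<le> n" for t
    unfolding Y_def using that by (auto intro!: Henstock_Kurzweil_Integration.integral_cong v'_le)
  have Y'_ge: "A + integral {-1..t} v' = w t" if t: "n \<le> t" "t \<le> n + 1" for t
  proof -
    have "integral {n..t} v' = integral {n..t} (\<lambda>t. q t - f (w t))"
      by (rule integral_spike[OF negligible_sing[of n]]) (auto simp: v'_def)
    also have "\<dots> = integral {n..t} q - integral {n..t} (\<lambda>t. f (w t))"
    proof (rule integral_diff)
      show "q integrable_on {n..t}" by (rule integrable_on_subinterval[OF qi]) (use t in auto)
      show "(\<lambda>t. f (w t)) integrable_on {n..t}"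
        by (intro integrable_continuous_real continuous_on_subset[OF cfw]) (use t in auto)
    qed
    finally have "integral {n..t} v' = w t - Y n" using w(2)[of t] t by (simp add: P_def)
    moreover have "integral {-1..t} v' = integral {-1..n} v' + integral {n..t} v'"
      by (rule integral_split_Icc[OF v'i]) (use t n in auto)
    ultimately show ?thesis using Y'_le[of n] by simp
  qed
  show thesis
  proof (rule that[OF L2 v'_le])
    fix t assume t: "n < t" "t \<le> n + 1"
    show "v' t + c * v' (t - 1) + f (A + integral {-1..t} v') + g (A + integral {-1..t - 1} v') = D"
      using t Y'_ge[of t] Y'_le[of "t - 1"] by (simp add: v'_def q_def)
  qed
qed

text \<open>Dependent choice yields a sequence of extensions, each leaving the past untouched, so
  that the sequence becomes stationary at every time and defines a global \<open>v\<close>.\<close>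

lemma neutral_primitive_exists:
  fixes f g v0 :: "real \<Rightarrow> real"
  assumes v0: "locally_L2_on v0 {-1..0}"
    and f: "mono f" "f 0 = 0" and f': "\<And>x. (f has_real_derivative f' x) (at x)" "continuous_on UNIV f'"
    and g: "continuous_on UNIV g"
  obtains v where "\<And>b. locally_L2_on v {-1..b}" "\<And>t. t \<le> 0 \<Longrightarrow> v t = v0 t"
    "\<And>t. 0 < t \<Longrightarrow>
       v t + c * v (t - 1) + f (A + integral {-1..t} v) + g (A + integral {-1..t - 1} v) = D"
proof -
  define eq where "eq = (\<lambda>(v::real \<Rightarrow> real) t. v t + c * v (t - 1) + f (A + integral {-1..t} v) + g (A + integral {-1..t - 1} v) = D)"
  define Q where "Q = (\<lambda>n v. locally_L2_on v {-1..real n} \<and> (\<forall>t. 0 < t \<and> t \<le> real n \<longrightarrow> eq v t) \<and> (\<forall>t\<le>0. v t = v0 t))"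
  \<comment> \<open>The equation at \<open>t\<close> looks only at values up to \<open>t\<close>, so
    it survives every later extension.\<close>
  have eq_cong: "eq v t = eq v' t" if "\<And>s. s \<le> t \<Longrightarrow> v s = v' s" for v v' :: "real \<Rightarrow> real" and t
  proof -
    have "integral {-1..t} v = integral {-1..t} v'" "integral {-1..t - 1} v = integral {-1..t - 1} v'"
      using that by (auto intro!: Henstock_Kurzweil_Integration.integral_cong)
    then show ?thesis using that by (simp add: eq_def)
  qed
  have "\<exists>V. \<forall>n. Q n (V n) \<and> (\<forall>t\<le>real n. V (Suc n) t = V n t)"
  proof (rule dependent_nat_choice)
    show "\<exists>v. Q 0 v" using v0 by (auto simp: Q_def)
    fix v n assume v: "Q n v"
    obtain v' where v': "locally_L2_on v' {-1..real n + 1}" "\<And>t. t \<le> real n \<Longrightarrow> v' t = v t"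
        "\<And>t. real n < t \<Longrightarrow> t \<le> real n + 1 \<Longrightarrow> eq v' t"
      using neutral_extension_step[of "real n" v f f' g c A D] v f f' g unfolding Q_def eq_def by auto
    have "eq v' t" if "0 < t" "t \<le> real (Suc n)" for t
    proof (cases "t \<le> real n")
      case True
      then have "eq v t" using v that by (simp add: Q_def)
      then show ?thesis using eq_cong[of t v' v] v'(2) True by simp
    next
      case False
      then show ?thesis using v'(3)[of t] that by simp
    qed
    moreover have "v' t = v0 t" if "t \<le> 0" for t using v v'(2)[of t] that by (simp add: Q_def)
    ultimately show "\<exists>v'. Q (Suc n) v' \<and> (\<forall>t\<le>real n. v' t = v t)"
      using v'(1,2) by (auto simp: Q_def add.commute)
  qed
  then obtain V where V: "\<And>n. Q n (V n)" "\<And>n t. t \<le> real n \<Longrightarrow> V (Suc n) t = V n t" by blast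
  have V_mono: "V (m + k) t = V m t" if "t \<le> real m" for m k t
  proof (induction k)
    case (Suc k)
    have "V (Suc (m + k)) t = V (m + k) t" by (rule V(2)) (use that in simp)
    then show ?case using Suc by simp
  qed simp
  \<comment> \<open>The first extension that reaches \<open>t\<close>. For negative \<open>t\<close>
    the index \<open>nat \<lceil>t\<rceil>\<close> is 0, which gives back \<open>v0\<close>.\<close>
  define v where "v = (\<lambda>t. V (nat \<lceil>t\<rceil>) t)"
  have v_eq: "v t = V n t" if "t \<le> real n" for t n
  proof -
    have "nat \<lceil>t\<rceil> \<le> n" using that by (simp add: ceiling_le_iff nat_le_iff)
    moreover have "t \<le> real (nat \<lceil>t\<rceil>)" by (rule real_nat_ceiling_ge)
    ultimately show ?thesis unfolding v_def using V_mono by (metis le_add_diff_inverse)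
  qed
  show thesis
  proof
    fix b
    obtain n where n: "b \<le> real n" using real_arch_simple by blast
    have "locally_L2_on (V n) {-1..real n}" using V(1) by (simp add: Q_def)
    then have "locally_L2_on v {-1..real n}"
      by (rule locally_L2_on_spike[OF _ negligible_empty]) (simp add: v_eq)
    then show "locally_L2_on v {-1..b}" by (rule locally_L2_on_subset) (use n in auto)
  next
    fix t :: real assume "t \<le> 0"
    then show "v t = v0 t" using v_eq[of t 0] V(1)[of 0] by (simp add: Q_def)
  next
    fix t :: real assume t: "0 < t"
    obtain n where n: "t \<le> real n" using real_arch_simple by blast
    have "eq (V n) t" using V(1)[of n] t n by (simp add: Q_def)
    then have "eq v t" using eq_cong[of t v "V n"] v_eq n by simp
    then show "v t + c * v (t - 1) + f (A + integral {-1..t} v) + g (A + integral {-1..t - 1} v) = D"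
      by (simp add: eq_def)
  qed
qed

text \<open>Global rather than local integrability of \<open>v\<^sup>2\<close> pays off here: with
  \<open>\<bar>v\<bar> \<le> 1 + v\<^sup>2\<close> on a bounded interval, \<open>v\<close> is
  integrable up to both ends, and integration may start at the left end.\<close>

lemma H1_weak_derivative:
  assumes "y0 \<in> H1 {a<..<b}"
  obtains v where "primitive_on y0 v {a<..<b}" "locally_L2_on v {a..b}"
proof -
  obtain v where v: "continuous_on {a<..<b} y0" "has_weak_derivative_on y0 v {a<..<b}" "square_integrable_on v {a<..<b}"
    using assms by (auto simp: H1_def)
  have "primitive_on y0 v {a<..<b}"
    by (rule primitive_of_weak_derivative[OF v(2,1)]) (auto simp: is_interval_1)
  moreover have "locally_L2_on v {a..b}"
    unfolding locally_L2_on_Icc absolutely_integrable_on_Icc_iff_Ioo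
  proof
    show sq: "(\<lambda>t. (v t)\<^sup>2) absolutely_integrable_on {a<..<b}"
      using v(3) by (simp add: square_integrable_on_def)
    show "v absolutely_integrable_on {a<..<b}"
    proof (rule measurable_bounded_by_integrable_imp_absolutely_integrable)
      show "v \<in> borel_measurable (lebesgue_on {a<..<b})"
        using v(3) unfolding square_integrable_on_def set_borel_measurable_def
        by (subst borel_measurable_restrict_space_iff) auto
      have "(\<lambda>t. 1 :: real) absolutely_integrable_on {a<..<b}"
        by (intro absolutely_integrable_on_const) simp
      then show "(\<lambda>t. 1 + (v t)\<^sup>2) integrable_on {a<..<b}"
        by (intro integrable_add abs_integrable_imp_integrable sq)
      show "norm (v t) \<le> 1 + (v t)\<^sup>2" for t
      proof -
        have "2 * \<bar>v t\<bar> \<le> 1 + (v t)\<^sup>2" using sum_squares_bound[of 1 "\<bar>v t\<bar>"] by simp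
        then show ?thesis by simp
      qed
    qed simp
  qed
  ultimately show thesis using that by blast
qed

lemma neutral_solution_exists:
  fixes f g :: "real \<Rightarrow> real"
  assumes f: "mono f" "f 0 = 0" and f': "\<And>x. (f has_real_derivative f' x) (at x)" "continuous_on UNIV f'"
    and g: "continuous_on UNIV g" and y0: "y0 \<in> H1 {-1<..<0}"
  shows "\<exists>y. neutral_solution c f g D y0 y"
proof -
  obtain v0 where v0: "primitive_on y0 v0 {-1<..<0}" "locally_L2_on v0 {-1..0}"
    using H1_weak_derivative[OF y0] .
  have v0i: "v0 integrable_on {-1..0}" using v0(2) by (simp add: locally_L2_on_Icc abs_integrable_imp_integrable)
  \<comment> \<open>The value of the solution at -1. It is computed from the interior point -1/2
    because \<open>y0\<close> means nothing at the ends of the open interval.\<close>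
  define A where "A = y0 (-1/2) - integral {-1..-1/2} v0"
  obtain v where v: "\<And>b. locally_L2_on v {-1..b}" "\<And>t. t \<le> 0 \<Longrightarrow> v t = v0 t"
    "\<And>t. 0 < t \<Longrightarrow> v t + c * v (t - 1) + f (A + integral {-1..t} v) + g (A + integral {-1..t - 1} v) = D"
    using neutral_primitive_exists[OF v0(2) f f' g] by metis
  define y where "y = (\<lambda>t. A + integral {-1..t} v)"
  have prim: "primitive_on y v {-1<..}"
    unfolding primitive_on_def
  proof (intro allI impI conjI)
    fix a b :: real assume ab: "a \<le> b" "{a..b} \<subseteq> {-1<..}"
    then have a: "-1 \<le> a" by (auto simp: subset_iff)
    have vb: "v absolutely_integrable_on {-1..b}" using v(1) by (simp add: locally_L2_on_Icc)
    then show "v absolutely_integrable_on {a..b}"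
      by (rule absolutely_integrable_on_subinterval) (use a in auto)
    show "y b - y a = integral {a..b} v"
      using integral_split_Icc[OF abs_integrable_imp_integrable[OF vb] a ab(1)] by (simp add: y_def)
  qed
  have "locally_L2_on v {-1<..}" unfolding locally_L2_on_def
  proof (intro allI impI)
    fix a b :: real assume "{a..b} \<subseteq> {-1<..}"
    then have "{a..b} \<subseteq> {-1..b}" by force
    then show "v absolutely_integrable_on {a..b} \<and> (\<lambda>t. (v t)\<^sup>2) absolutely_integrable_on {a..b}"
      using v(1) unfolding locally_L2_on_def by blast
  qed
  moreover have "y t = y0 t" if t: "t \<in> {-1<..<0}" for t
  proof -
    have yt: "y t = A + integral {-1..t} v0"
      unfolding y_def using t v(2) by (auto intro!: Henstock_Kurzweil_Integration.integral_cong)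
    have int: "v0 integrable_on {-1..s}" if "s \<le> 0" for s
      by (rule integrable_on_subinterval[OF v0i]) (use that in auto)
    show ?thesis
    proof (cases "-1/2 \<le> t")
      case True
      have "y0 t - y0 (-1/2) = integral {-1/2..t} v0"
        by (rule primitive_onD(3)[OF v0(1) True]) (use t in auto)
      moreover have "integral {-1..t} v0 = integral {-1..-1/2} v0 + integral {-1/2..t} v0"
        by (rule integral_split_Icc[OF int]) (use t True in auto)
      ultimately show ?thesis using yt by (simp add: A_def)
    next
      case False
      have "y0 (-1/2) - y0 t = integral {t..-1/2} v0"
        by (rule primitive_onD(3)[OF v0(1)]) (use t False in auto)
      moreover have "integral {-1..-1/2} v0 = integral {-1..t} v0 + integral {t..-1/2} v0"
        by (rule integral_split_Icc[OF int]) (use t False in auto)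
      ultimately show ?thesis using yt by (simp add: A_def)
    qed
  qed
  ultimately have "neutral_solution c f g D y0 y"
    unfolding neutral_solution_iff using prim v(3)
    by (auto simp: y_def intro!: exI[of _ v] exI[of _ "{}"])
  then show ?thesis by blast
qed

section \<open>Constant solutions and comparison of the increments of \<open>g\<close> with those of
  \<open>f\<close>\<close>

lemma const_in_H1: "(\<lambda>_. d) \<in> H1 {a<..<b}"
proof -
  have "primitive_on (\<lambda>_. d) (\<lambda>_. 0) UNIV" by (simp add: primitive_on_def)
  moreover have "locally_L2_on (\<lambda>_. 0) UNIV" by (simp add: locally_L2_on_def)
  ultimately have "(\<lambda>_. d) \<in> H1_loc UNIV" by (rule H1_loc_of_primitive) (auto simp: is_interval_1)
  then show ?thesis by (simp add: H1_loc_def)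
qed

lemma neutral_solution_const:
  assumes "f d + g d = D"
  shows "neutral_solution c f g D (\<lambda>_. d) (\<lambda>_. d)"
  unfolding neutral_solution_iff using assms
  by (auto simp: primitive_on_def locally_L2_on_def intro!: exI[of _ "\<lambda>_. 0"] exI[of _ "{}"])

theorem corollary2:
  fixes c \<gamma> D :: real and f g :: "real \<Rightarrow> real"
  assumes "c \<in> {-1, 1}"
    and "\<forall>x. f differentiable (at x)" and "continuous_on UNIV (deriv f)"
    and "\<forall>x. deriv f x > 0" and "f 0 = 0"
    and "\<forall>x. g differentiable (at x)"
    and "0 \<le> \<gamma>" and "\<gamma> < 1"
    and "\<forall>x. \<bar>g x\<bar> \<le> \<gamma> * \<bar>f x\<bar>"
    and "\<forall>x. \<bar>deriv g x\<bar> \<le> \<gamma> * \<bar>deriv f x\<bar>"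
    and "filterlim f at_top at_top" and "filterlim f at_bot at_bot"
  shows "(\<exists>!d. f d + g d = D) \<and>
    (\<forall>d. f d + g d = D \<longrightarrow>
       globally_attractive_constant c f g D d \<and>
       (\<forall>e. globally_attractive_constant c f g D e \<longrightarrow> e = d))"
proof -
  have c: "c\<^sup>2 = 1" using assms(1) by auto
  have f': "(f has_real_derivative deriv f x) (at x)" and g': "(g has_real_derivative deriv g x) (at x)" for x
    using assms(2,6) DERIV_deriv_iff_real_differentiable by blast+
  have cf: "continuous_on UNIV f" and cg: "continuous_on UNIV g"
    using f' g' by (meson DERIV_isCont continuous_at_imp_continuous_on)+
  have f_mono: "strict_mono f"
  proof (rule strict_monoI)
    fix x y :: real assume "x < y"
    then show "f x < f y" by (rule DERIV_pos_imp_increasing) (use f' assms(4) in blast)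
  qed
  have \<gamma>f: "\<bar>deriv g x\<bar> \<le> \<gamma> * deriv f x" for x using assms(4,10) by (metis abs_of_pos)
  \<comment> \<open>The derivative bound makes \<open>\<gamma> * f + g\<close> and
    \<open>\<gamma> * f - g\<close> nondecreasing, which compares increments from an arbitrary base
    point \<open>d\<close>, as the energy argument centred at the equilibrium requires.\<close>
  have diff: "\<bar>g x - g d\<bar> \<le> \<gamma> * \<bar>f x - f d\<bar>" for x d
  proof -
    have le: "\<bar>g x - g d\<bar> \<le> \<gamma> * (f x - f d)" if "d \<le> x" for x d
    proof -
      have "\<gamma> * f d + s * g d \<le> \<gamma> * f x + s * g x" if s: "\<bar>s\<bar> = 1" for s
      proof (rule DERIV_nonneg_imp_nondecreasing[OF \<open>d \<le> x\<close>])
        fix r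
        have "\<bar>s * deriv g r\<bar> \<le> \<gamma> * deriv f r" using \<gamma>f s by (simp add: abs_mult)
        then have "0 \<le> \<gamma> * deriv f r + s * deriv g r" by (simp add: abs_le_iff)
        moreover have "((\<lambda>x. \<gamma> * f x + s * g x) has_real_derivative \<gamma> * deriv f r + s * deriv g r) (at r)"
          by (auto intro!: derivative_eq_intros f' g')
        ultimately show "\<exists>y. ((\<lambda>x. \<gamma> * f x + s * g x) has_real_derivative y) (at r) \<and> 0 \<le> y" by blast
      qed
      from this[of 1] this[of "-1"] show ?thesis by (simp add: abs_le_iff algebra_simps)
    qed
    show ?thesis
    proof (cases "d \<le> x")
      case True
      then have "f d \<le> f x" using strict_mono_mono[OF f_mono] by (simp add: mono_def)
      then show ?thesis using le[OF True] by simp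
    next
      case False
      then have "f x \<le> f d" using strict_mono_mono[OF f_mono] by (simp add: mono_def)
      then show ?thesis using le[of x d] False by (simp add: abs_minus_commute)
    qed
  qed
  have less: "f x + g x < f y + g y" if "x < y" for x y
  proof -
    have "f x < f y" using strict_monoD[OF f_mono that] .
    then have "\<gamma> * \<bar>f y - f x\<bar> < f y - f x" using assms(8) by simp
    then show ?thesis using diff[of y x] by (simp add: abs_le_iff)
  qed
  have ex: "\<exists>d. f d + g d = D"
  proof -
    \<comment> \<open>Where \<open>f x \<ge> M\<close>, the bound on \<open>g\<close> gives
      \<open>f x + g x \<ge> (1 - \<gamma>) * f x \<ge> \<bar>D\<bar>\<close>; symmetrically for
      \<open>f x \<le> - M\<close>. So \<open>D\<close> is enclosed for the intermediate value
      theorem.\<close>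
    define M where "M = \<bar>D\<bar> / (1 - \<gamma>)"
    have M: "(1 - \<gamma>) * M = \<bar>D\<bar>" using assms(8) by (simp add: M_def)
    obtain b where b: "\<And>x. b \<le> x \<Longrightarrow> M \<le> f x"
      using assms(11) unfolding filterlim_at_top eventually_at_top_linorder by blast
    obtain a where a: "\<And>x. x \<le> a \<Longrightarrow> f x \<le> - M"
      using assms(12) unfolding filterlim_at_bot eventually_at_bot_linorder by blast
    have M0: "0 \<le> M" using assms(8) by (simp add: M_def)
    have "f (max a b) \<ge> M" using b by simp
    then have "(1 - \<gamma>) * M \<le> (1 - \<gamma>) * f (max a b)" using assms(8) by (intro mult_left_mono) auto
    moreover have "\<bar>g (max a b)\<bar> \<le> \<gamma> * f (max a b)"
      using assms(9) \<open>f (max a b) \<ge> M\<close> M0 by (metis abs_of_nonneg order_trans)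
    ultimately have hi: "D \<le> f (max a b) + g (max a b)"
      using abs_ge_self[of D] unfolding M by (simp add: left_diff_distrib abs_le_iff)
    have "f (min a b) \<le> - M" using a by simp
    then have "(1 - \<gamma>) * f (min a b) \<le> (1 - \<gamma>) * (- M)" using assms(8) by (intro mult_left_mono) auto
    moreover have "\<bar>g (min a b)\<bar> \<le> - (\<gamma> * f (min a b))"
    proof -
      have "\<bar>f (min a b)\<bar> = - f (min a b)" using \<open>f (min a b) \<le> - M\<close> M0 by linarith
      then show ?thesis using assms(9)[rule_format, of "min a b"] by simp
    qed
    ultimately have lo: "f (min a b) + g (min a b) \<le> D"
      using abs_ge_minus_self[of D] M by (simp add: left_diff_distrib abs_le_iff)
    have "\<exists>x. min a b \<le> x \<and> x \<le> max a b \<and> f x + g x = D"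
      by (rule IVT'[of "\<lambda>x. f x + g x", OF lo hi]) (auto intro!: continuous_intros continuous_on_subset[OF cf] continuous_on_subset[OF cg])
    then show ?thesis by blast
  qed
  have uniq: "x = y" if "f x + g x = D" "f y + g y = D" for x y
    using less[of x y] less[of y x] that by (metis less_irrefl linorder_neqE)
  have gac: "globally_attractive_constant c f g D d" if d: "f d + g d = D" for d
    unfolding globally_attractive_constant_def
  proof (intro conjI ballI allI impI)
    show "neutral_solution c f g D (\<lambda>_. d) (\<lambda>_. d)" by (rule neutral_solution_const[of f d g, OF d])
    fix y0 assume "y0 \<in> H1 {-1<..<0}"
    then show "\<exists>y. neutral_solution c f g D y0 y"
      by (rule neutral_solution_exists[OF strict_mono_mono[OF f_mono] assms(5) f' assms(3) cg])
  next
    fix y0 y z t assume "neutral_solution c f g D y0 y \<and> neutral_solution c f g D y0 z" "-1 < (t::real)"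
    then show "y t = z t"
      using neutral_solution_unique[OF strict_mono_mono[OF f_mono] cf cg] by blast
  next
    fix y0 y assume "neutral_solution c f g D y0 y"
    then show "(y \<longlongrightarrow> d) at_top"
      by (rule neutral_solution_tendsto[where f = f and g = g and d = d, OF c f_mono cf cg assms(7,8) diff d])
  qed
  \<comment> \<open>A rival attractor \<open>e\<close> is itself a constant solution with admissible
    initial data, so it must converge to \<open>d\<close>.\<close>
  have "e = d" if d: "f d + g d = D" and e: "globally_attractive_constant c f g D e" for d e
  proof -
    have sol: "neutral_solution c f g D (\<lambda>_. e) (\<lambda>_. e)"
      using e by (simp add: globally_attractive_constant_def)
    have "\<forall>y0\<in>H1 {-1<..<0}. \<forall>y. neutral_solution c f g D y0 y \<longrightarrow> (y \<longlongrightarrow> d) at_top"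
      using gac[OF d] unfolding globally_attractive_constant_def by blast
    note attr = bspec[OF this const_in_H1[of e]]
    have "((\<lambda>_::real. e) \<longlongrightarrow> d) at_top" by (rule attr[rule_format, OF sol])
    then show ?thesis by (simp add: tendsto_const_iff)
  qed
  with ex uniq gac show ?thesis by blast
qed

end
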